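(* Let $n$ be a positive integer and let $c_1,\dots,c_n$ be nonnegative integers with $c_1+\cdots+c_n=n$. Let $\mathbf{i}=(i_1,\dots,i_n)\in\{1,\dots,n\}^n$ be any sequence such that $u_{i_1}\cdots u_{i_n}=u_1^{c_1}\cdots u_n^{c_n}$ (as monomials in the variables $u_1,\dots,u_n$). Then the mixed Eulerian number $A_{c_1,\dots,c_n}$ equals $$A_{c_1,\dots,c_n}=\sum_{(T,v)}n!\;wt(\mathbf{i},T,v),$$ where the sum is over $\mathbf{i}$-compatible increasing binary trees $(T,v)$ with $n$ nodes.
   Context: Mixed Eulerian numbers: for $1\le k\le n$, the hypersimplex $\Delta_{k,n+1}\subset\mathbb{R}^{n+1}$ is the convex hull of all $0/1$-vectors with exactly $k$ ones; $\mathrm{Vol}$ of a polytope in a hyperplane $t_1+\cdots+t_{n+1}=c$ is the usual $n$-dimensional volume of its image under the projection $(t_1,\dots,t_{n+1})\mapsto(t_1,\dots,t_n)$. For $u_1,\dots,u_n\ge0$, the volume of the Minkowski sum $u_1\Delta_{1,n+1}+\cdots+u_n\Delta_{n,n+1}$ is a homogeneous polynomial of degree $n$, and the $A_{c_1,\dots,c_n}$ are defined by $\mathrm{Vol}(u_1\Delta_{1,n+1}+\cdots+u_n\Delta_{n,n+1})=\sum A_{c_1,\dots,c_n}\frac{u_1^{c_1}}{c_1!}\cdots\frac{u_n^{c_n}}{c_n!}$. Trees: a plane binary tree is a rooted tree in which each node has at most one left child and at most one right child (an only child is specified to be left or right). The nodes of a plane binary tree $T$ with $n$ nodes are labeled by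 $1,\dots,n$ via the binary search labeling: the unique labeling such that for every node all labels in its left branch are less than its label and all labels in its right branch are greater than its label. $\mathrm{desc}(j,T)$ is the set of descendants of $j$ (including $j$); it is an interval $[l_j,r_j]$ of integers. For $i\in\mathrm{desc}(j,T)$ define $$wt(i,j)=\min\left(\frac{i-l_j+1}{j-l_j+1},\frac{r_j-i+1}{r_j-j+1}\right).$$ An increasing labeling of $T$ is a permutation $v\in S_n$ such that $v(i)\ge v(j)$ whenever $i\in\mathrm{desc}(j,T)$. An increasing binary tree $(T,v)$ is a plane binary tree $T$ (with binary search labeling) together with an increasing labeling $v$. For $\mathbf{i}=(i_1,\dots,i_n)\in\{1,\dots,n\}^n$, $(T,v)$ is $\mathbf{i}$-compatible if $i_{v(j)}\in[l_j,r_j]$ for $j=1,\dots,n$, and in that case its $\mathbf{i}$-weight is $wt(\mathbf{i},T,v)=\prod_{j=1}^nwt(i_{v(j)},j)$. *)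

theory Defs
  imports
    "HOL-Analysis.Analysis"
    "HOL-Combinatorics.Permutations"
    "HOL-Library.Function_Algebras"
    "HOL-Library.Poly_Mapping"
    "HOL-Library.Set_Algebras"
    "HOL-Library.Tree"
begin

text \<open>
  A point of \<open>\<real>\<^sup>m\<close> is a function \<open>nat \<Rightarrow> real\<close> whose coordinates are indexed by \<open>1, \<dots>, m\<close> and
  which vanishes elsewhere; the dimension can thus be an ordinary variable. The pointwise vector
  space structure gives access to the library's \<open>convex hull\<close>.
\<close>

instantiation "fun" :: (type, real_vector) real_vector
begin

definition scaleR_fun :: "real \<Rightarrow> ('a \<Rightarrow> 'b) \<Rightarrow> 'a \<Rightarrow> 'b"
  where "scaleR_fun r f = (\<lambda>x. r *\<^sub>R f x)"

instance
  by standard (auto simp: scaleR_fun_def fun_eq_iff scaleR_add_right scaleR_add_left)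

end

definition hypersimplex :: "nat \<Rightarrow> nat \<Rightarrow> (nat \<Rightarrow> real) set"
  where "hypersimplex k m =
    convex hull {t. (\<forall>i. t i \<in> {0, 1}) \<and> (\<forall>i. i \<notin> {1..m} \<longrightarrow> t i = 0) \<and>
                    card {i \<in> {1..m}. t i = 1} = k}"

text \<open>
  For a polytope in a hyperplane \<open>t\<^sub>1 + \<dots> + t\<^sub>n\<^sub>+\<^sub>1 = c\<close>: the Lebesgue measure of its image under
  the projection to the first \<open>n\<close> coordinates. (Elements of the product space are functions
  that are \<open>undefined\<close> outside \<open>{1..n}\<close>, hence \<^const>\<open>restrict\<close>.)
\<close>

definition proj_volume :: "nat \<Rightarrow> (nat \<Rightarrow> real) set \<Rightarrow> real"
  where "proj_volume n P =
    measure (PiM {1..n} (\<lambda>_. lborel)) ((\<lambda>t. restrict t {1..n}) ` P)"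

definition hypersimplex_sum :: "nat \<Rightarrow> (nat \<Rightarrow> real) \<Rightarrow> (nat \<Rightarrow> real) set"
  where "hypersimplex_sum n u = (\<Sum>k=1..n. (*\<^sub>R) (u k) ` hypersimplex k (n + 1))"

definition exponents :: "nat \<Rightarrow> (nat \<Rightarrow> nat) set"
  where "exponents n = {c \<in> {1..n} \<rightarrow>\<^sub>E UNIV. (\<Sum>k=1..n. c k) = n}"

text \<open>
  The family of all coefficients \<open>A\<^bsub>c\<^sub>1,\<dots>,c\<^sub>n\<^esub>\<close> of the volume polynomial. The family is taken to be
  extensional, so that the identity of polynomial functions determines it uniquely.
\<close>

definition mixed_eulerian_family :: "nat \<Rightarrow> (nat \<Rightarrow> nat) \<Rightarrow> real"
  where "mixed_eulerian_family n =
    (THE A. A \<in> extensional (exponents n) \<and>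
       (\<forall>u. (\<forall>k\<in>{1..n}. 0 \<le> u k) \<longrightarrow>
          proj_volume n (hypersimplex_sum n u) =
            (\<Sum>c\<in>exponents n. A c * (\<Prod>k=1..n. u k ^ c k / fact (c k)))))"

definition mixed_eulerian :: "nat \<Rightarrow> (nat \<Rightarrow> nat) \<Rightarrow> real"
  where "mixed_eulerian n c = mixed_eulerian_family n (restrict c {1..n})"

text \<open>
  \<open>(nat \<Rightarrow>\<^sub>0 nat) \<Rightarrow>\<^sub>0 int\<close> is the polynomial ring over the integers in variables indexed by \<open>nat\<close>.
\<close>

definition variable :: "nat \<Rightarrow> (nat \<Rightarrow>\<^sub>0 nat) \<Rightarrow>\<^sub>0 int"
  where "variable k = Poly_Mapping.single (Poly_Mapping.single k 1) 1"

text \<open>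
  A plane binary tree with \<open>n\<close> nodes is identified with its binary search labeling by
  \<open>1, \<dots>, n\<close>, which it determines uniquely. A \<^const>\<open>Leaf\<close> stands for an absent child.
\<close>

definition plane_binary_trees :: "nat \<Rightarrow> nat tree set"
  where "plane_binary_trees n = {T. size T = n \<and> set_tree T = {1..n} \<and> bst T}"

definition desc :: "nat \<Rightarrow> nat tree \<Rightarrow> nat set"
  where "desc j T = {i. \<exists>L R. Node L j R \<in> subtrees T \<and> i \<in> set_tree (Node L j R)}"

definition desc_min :: "nat \<Rightarrow> nat tree \<Rightarrow> nat"
  where "desc_min j T = Min (desc j T)"

definition desc_max :: "nat \<Rightarrow> nat tree \<Rightarrow> nat"
  where "desc_max j T = Max (desc j T)"

definition wt :: "nat tree \<Rightarrow> nat \<Rightarrow> nat \<Rightarrow> real"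
  where "wt T i j =
    min ((real i - real (desc_min j T) + 1) / (real j - real (desc_min j T) + 1))
        ((real (desc_max j T) - real i + 1) / (real (desc_max j T) - real j + 1))"

definition increasing_labeling :: "nat \<Rightarrow> nat tree \<Rightarrow> (nat \<Rightarrow> nat) \<Rightarrow> bool"
  where "increasing_labeling n T v \<longleftrightarrow>
    v permutes {1..n} \<and> (\<forall>j\<in>{1..n}. \<forall>i\<in>desc j T. v i \<ge> v j)"

definition increasing_binary_trees :: "nat \<Rightarrow> (nat tree \<times> (nat \<Rightarrow> nat)) set"
  where "increasing_binary_trees n =
    {(T, v). T \<in> plane_binary_trees n \<and> increasing_labeling n T v}"

definition compatible :: "nat \<Rightarrow> (nat \<Rightarrow> nat) \<Rightarrow> nat tree \<Rightarrow> (nat \<Rightarrow> nat) \<Rightarrow> bool"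
  where "compatible n i T v \<longleftrightarrow> (\<forall>j\<in>{1..n}. i (v j) \<in> {desc_min j T..desc_max j T})"

definition tree_weight :: "nat \<Rightarrow> (nat \<Rightarrow> nat) \<Rightarrow> nat tree \<Rightarrow> (nat \<Rightarrow> nat) \<Rightarrow> real"
  where "tree_weight n i T v = (\<Prod>j=1..n. wt T (i (v j)) j)"

end

theory Submission
  imports Defs
begin

text \<open>
  Write \<open>x\<^sub>i = u\<^sub>i + \<dots> + u\<^sub>n\<close>. The Minkowski sum of the hypersimplices is the permutohedron of all
  points majorized by \<open>(x\<^sub>1, \<dots>, x\<^sub>n\<^sub>+\<^sub>1)\<close>, and its section by \<open>t = s\<close> for one coordinate \<open>t\<close> and
  \<open>x\<^sub>k \<ge> s \<ge> x\<^sub>k\<^sub>+\<^sub>1\<close> is the permutohedron in which \<open>x\<^sub>k, x\<^sub>k\<^sub>+\<^sub>1\<close> are replaced by the single entry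
  \<open>x\<^sub>k + x\<^sub>k\<^sub>+\<^sub>1 - s\<close>. Hence its volume satisfies an integral recursion, by Fubini.

  Splitting an increasing tree at its root \<open>k\<close> shows that the generating polynomial \<open>Q(a, b)\<close> of
  the tree sums over trees with nodes \<open>a, \<dots>, b - 1\<close> has the partial derivatives
  \<open>\<partial>\<^sub>i Q(a, b) = \<Sum>\<^sub>k wt(i, k) Q(a, k) Q(k + 1, b)\<close>. With respect to the \<open>x\<^sub>i\<close> the coefficients become
  binomial, and Euler's identity, integration by parts and Pascal's rule give the same integral
  recursion for \<open>n! Q(1, n + 1)\<close>.
\<close>

text \<open>The obstacle is order. A tree reads the word i letter by letter, whereas a coefficient
  of a polynomial may depend only on the multiset of letters. Without order independence,
  differentiating Q by u_i could not be described by making i the letter at the root.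

  An increasing labeling is smallest at the root, so the root k takes the first letter, and
  compatibility sends each later letter to the side of k on which it lies. Order independence
  therefore reduces to exchanging the first two letters. As a function of i, wt(i, k) is a hat:
  linear on both sides of its peak k and zero just outside the interval. For two nodes p < q the
  hats expand in a common two-element basis, and the combined weight becomes a symmetric bilinear
  form.

  The hat shape also explains the change to the x_i: the increments of a hat are constant on either
  side of k, so in the derivative by x_j the coefficient of Q(a, k) Q(k + 1, b) sees j only through
  j <= k. This is what makes derivatives compatible with merging two neighbouring entries.\<close>

section \<open>Tree weights as functions of words\<close>

text \<open>The weight wt(i, k) for a root k of a tree with nodes a, ..., b - 1. As a function of i
  it has peak 1 at k and vanishes at a - 1 and at b.\<close>

definition tent :: "nat \<Rightarrow> nat \<Rightarrow> nat \<Rightarrow> nat \<Rightarrow> real"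
  where "tent a b i k =
    min ((real i - real a + 1) / (real k - real a + 1)) ((real b - real i) / (real b - real k))"

text \<open>The root k reads the first letter. The descendant intervals below it avoid k, so a later
  letter equal to k fits no node; hence the set difference. The remaining letters are forced to the
  left or to the right and keep their order.\<close>

fun word_weight :: "nat \<Rightarrow> nat \<Rightarrow> nat list \<Rightarrow> real"
  where
    "word_weight a b [] = (if b \<le> a then 1 else 0)"
  | "word_weight a b (i # w) =
      (\<Sum>k\<in>{a..<b} - set w. tent a b i k * word_weight a k (filter (\<lambda>j. j < k) w) *
         word_weight (Suc k) b (filter (\<lambda>j. k < j) w))"

lemma length_filter_split:
  fixes k :: "'a :: linorder"
  assumes "k \<notin> set w"
  shows "length (filter (\<lambda>j. j < k) w) + length (filter (\<lambda>j. k < j) w) = length w"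
  using assms by (induction w) auto

text \<open>Every node consumes exactly one letter. This lets sums over all multisets of one size be
  cut down to those that split correctly at the root.\<close>

lemma word_weight_eq_0:
  assumes "length w \<noteq> b - a"
  shows "word_weight a b w = 0"
  using assms
proof (induction a b w rule: word_weight.induct)
  case (2 a b i w)
  have "word_weight a k (filter (\<lambda>j. j < k) w) *
         word_weight (Suc k) b (filter (\<lambda>j. k < j) w) = 0" if k: "k \<in> {a..<b} - set w" for k
  proof -
    from k have "length (filter (\<lambda>j. j < k) w) + length (filter (\<lambda>j. k < j) w) = length w"
      by (intro length_filter_split) auto
    with k "2.prems" have "length (filter (\<lambda>j. j < k) w) \<noteq> k - a \<or>
       length (filter (\<lambda>j. k < j) w) \<noteq> b - Suc k"
      by auto
    then show ?thesis using "2.IH" k by auto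
  qed
  then show ?case
    unfolding word_weight.simps by (intro sum.neutral ballI) (metis mult.assoc mult_zero_right)
qed auto

lemma tent_shift [simp]: "tent (Suc a) (Suc b) (Suc i) (Suc k) = tent a b i k"
  by (simp add: tent_def)

lemma word_weight_shift:
  "word_weight (Suc a) (Suc b) (map Suc w) = word_weight a b w"
proof (induction a b w rule: word_weight.induct)
  case (2 a b i w)
  have "word_weight (Suc a) (Suc b) (map Suc (i # w)) =
      (\<Sum>k\<in>Suc ` ({a..<b} - set w). tent (Suc a) (Suc b) (Suc i) k *
         word_weight (Suc a) k (filter (\<lambda>j. j < k) (map Suc w)) *
         word_weight (Suc k) (Suc b) (filter (\<lambda>j. k < j) (map Suc w)))"
    by (simp add: image_set_diff)
  also have "\<dots> = word_weight a b (i # w)"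
    by (subst sum.reindex) (auto simp: filter_map o_def 2 intro!: sum.cong)
  finally show ?case .
qed auto

text \<open>For \<open>p < q\<close> these are the nodal basis of the piecewise linear functions with breaks at \<open>p\<close> and
  \<open>q\<close> only; expanding the tents in it exhibits the symmetry in \<open>tent_product_symmetric\<close>.\<close>

definition left_tent :: "nat \<Rightarrow> nat \<Rightarrow> nat \<Rightarrow> nat \<Rightarrow> real"
  where "left_tent a p q i = (if i < q then tent a q i p else 0)"

definition right_tent :: "nat \<Rightarrow> nat \<Rightarrow> nat \<Rightarrow> nat \<Rightarrow> real"
  where "right_tent b p q i = (if p < i then tent (Suc p) b i q else 0)"

section \<open>Tents in the nodal basis\<close>

lemma tent_eq_left_part:
  assumes "a \<le> k" "k < b" "i \<le> k" "a \<le> i"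
  shows "tent a b i k = (real i - real a + 1) / (real k - real a + 1)"
proof -
  have "(real i - real a + 1) / (real k - real a + 1) \<le> 1"
     using assms by (simp add: divide_simps)
  moreover have "1 \<le> (real b - real i) / (real b - real k)"
     using assms by (simp add: divide_simps)
  ultimately show ?thesis unfolding tent_def by linarith
qed

lemma tent_eq_right_part:
  assumes "a \<le> k" "k < b" "k \<le> i"
  shows "tent a b i k = (real b - real i) / (real b - real k)"
proof -
  have "1 \<le> (real i - real a + 1) / (real k - real a + 1)"
     using assms by (simp add: divide_simps)
  moreover have "(real b - real i) / (real b - real k) \<le> 1"
     using assms by (simp add: divide_simps)
  ultimately show ?thesis unfolding tent_def by linarith
qed

text \<open>Linear interpolation on a segment of length \<open>D\<close> between the values
  \<open>P / Q\<close> and 1, at distance \<open>E\<close> from the first end and \<open>S\<close>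
  from the second.\<close>

lemma add_divide_interpolate:
  fixes P D E :: real
  assumes "P > 0" "D > 0" "Q = P + D" "R = P + E" "S = D - E"
  shows "R / Q = E / D + P / Q * (S / D)"
proof -
  have "Q \<noteq> 0" "D \<noteq> 0" using assms by auto
  then have "E / D + P / Q * (S / D) = (Q * E + P * S) / (Q * D)"
    by (simp add: add_divide_distrib)
  also have "Q * E + P * S = R * D" unfolding assms(3-5) by (simp add: algebra_simps)
  finally show ?thesis using \<open>D \<noteq> 0\<close> by simp
qed

text \<open>The coefficients are the values at the breaks: 1 at \<open>q\<close> and
  \<open>tent a b p q\<close> at \<open>p\<close>.\<close>

lemma tent_nodal_right:
  assumes "a \<le> p" "p < q" "q < b" "a \<le> i" "i < b"
  shows "tent a b i q = right_tent b p q i + tent a b p q * left_tent a p q i"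
proof -
  consider "i \<le> p" | "p < i" "i < q" | "q \<le> i" by linarith
  then show ?thesis
  proof cases
    case 2
    then have "tent a b i q = (real i - real a + 1) / (real q - real a + 1)"
      "right_tent b p q i = (real i - real p) / (real q - real p)"
      "tent a b p q = (real p - real a + 1) / (real q - real a + 1)"
      "left_tent a p q i = (real q - real i) / (real q - real p)"
      using assms by (auto simp: tent_eq_left_part tent_eq_right_part left_tent_def right_tent_def)
    moreover have "(real i - real a + 1) / (real q - real a + 1) = (real i - real p) / (real q - real p) +
        (real p - real a + 1) / (real q - real a + 1) * ((real q - real i) / (real q - real p))"
      by (rule add_divide_interpolate) (use assms in auto)
    ultimately show ?thesis by simp
  qed (use assms in \<open>auto simp: tent_eq_left_part tent_eq_right_part left_tent_def right_tent_def\<close>)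
qed

lemma tent_nodal_left:
  assumes "a \<le> p" "p < q" "q < b" "a \<le> i" "i < b"
  shows "tent a b i p = left_tent a p q i + tent a b q p * right_tent b p q i"
proof -
  consider "i \<le> p" | "p < i" "i < q" | "q \<le> i" by linarith
  then show ?thesis
  proof cases
    case 2
    then have "tent a b i p = (real b - real i) / (real b - real p)"
      "right_tent b p q i = (real i - real p) / (real q - real p)"
      "tent a b q p = (real b - real q) / (real b - real p)"
      "left_tent a p q i = (real q - real i) / (real q - real p)"
      using assms by (auto simp: tent_eq_left_part tent_eq_right_part left_tent_def right_tent_def)
    moreover have "(real b - real i) / (real b - real p) = (real q - real i) / (real q - real p) +
        (real b - real q) / (real b - real p) * ((real i - real p) / (real q - real p))"
      by (rule add_divide_interpolate) (use assms in auto)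
    ultimately show ?thesis by simp
  qed (use assms in \<open>auto simp: tent_eq_left_part tent_eq_right_part left_tent_def right_tent_def\<close>)
qed

text \<open>Write L, R for the nodal functions, \<alpha> for \<open>tent a b p q\<close> and \<beta>
  for \<open>tent a b q p\<close>. Both sides expand to R_i L_j + L_i R_j + \<alpha> L_i L_j +
  \<beta> R_i R_j.\<close>

lemma tent_product_symmetric:
  assumes "a \<le> p" "p < q" "q < b" "i \<in> {a..<b}" "j \<in> {a..<b}"
  shows "tent a b i q * left_tent a p q j + tent a b i p * right_tent b p q j =
    tent a b j q * left_tent a p q i + tent a b j p * right_tent b p q i"
  using assms
  by (simp add: tent_nodal_left[of a p q b i] tent_nodal_left[of a p q b j]
    tent_nodal_right[of a p q b i] tent_nodal_right[of a p q b j] algebra_simps)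

text \<open>The first two letters are read by the root and by one of its children. With p < q these
  two nodes, either q is the root and p its left child, or p is the root and q its right child. Both
  cases leave the same three intervals and the same three subwords, so only the two leading weights
  depend on i and j.\<close>

lemma word_weight_Cons2:
  assumes "i \<in> {a..<b}" "j \<in> {a..<b}"
  shows "word_weight a b (i # j # w) =
    (\<Sum>(p, q)\<in>{(p, q). p \<in> {a..<b} - set w \<and> q \<in> {a..<b} - set w \<and> p < q}.
      (tent a b i q * left_tent a p q j + tent a b i p * right_tent b p q j) *
      (word_weight a p (filter (\<lambda>x. x < p) w) *
       word_weight (Suc p) q (filter (\<lambda>x. p < x \<and> x < q) w) *
       word_weight (Suc q) b (filter (\<lambda>x. q < x) w)))"
    (is "_ = (\<Sum>(p, q)\<in>?P. (?l p q + ?r p q) * ?T p q)")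
proof -
  let ?S = "{a..<b} - set w"
  have *: "tent a b i k * word_weight a k (filter (\<lambda>x. x < k) (j # w)) *
       word_weight (Suc k) b (filter (\<lambda>x. k < x) (j # w)) =
     (\<Sum>m\<in>{m\<in>?S. m < k}. ?l m k * ?T m k) + (\<Sum>m\<in>{m\<in>?S. k < m}. ?r k m * ?T k m)"
    if k: "k \<in> ?S - {j}" for k
  proof (cases "j < k")
    case True
    have S: "{a..<k} - set (filter (\<lambda>x. x < k) w) = {m\<in>?S. m < k}"
      using k by auto
    have f: "filter (\<lambda>x. x < m) (filter (\<lambda>x. x < k) w) = filter (\<lambda>x. x < m) w"
      "filter (\<lambda>x. m < x) (filter (\<lambda>x. x < k) w) = filter (\<lambda>x. m < x \<and> x < k) w" if "m < k" for m
      using that by (auto simp: filter_filter intro!: filter_cong)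
    have "word_weight a k (filter (\<lambda>x. x < k) (j # w)) = (\<Sum>m\<in>{m\<in>?S. m < k}.
        tent a k j m * word_weight a m (filter (\<lambda>x. x < m) w) *
          word_weight (Suc m) k (filter (\<lambda>x. m < x \<and> x < k) w))"
      using True by (simp only: filter.simps if_True word_weight.simps S)
        (auto simp only: f intro!: sum.cong)
    moreover have "filter (\<lambda>x. k < x) (j # w) = filter (\<lambda>x. k < x) w" using True by simp
    moreover have "?l m k = tent a b i k * tent a k j m" for m
      using True by (simp add: left_tent_def)
    ultimately have "tent a b i k * word_weight a k (filter (\<lambda>x. x < k) (j # w)) *
       word_weight (Suc k) b (filter (\<lambda>x. k < x) (j # w)) =
       (\<Sum>m\<in>{m\<in>?S. m < k}. ?l m k * ?T m k)"
      by (simp only: sum_distrib_left sum_distrib_right mult_ac)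
    moreover have "(\<Sum>m\<in>{m\<in>?S. k < m}. ?r k m * ?T k m) = 0"
      using True by (intro sum.neutral) (auto simp: right_tent_def)
    ultimately show ?thesis by simp
  next
    case False
    with k have "k < j" by auto
    have S: "{Suc k..<b} - set (filter (\<lambda>x. k < x) w) = {m\<in>?S. k < m}"
      using k by auto
    have f: "filter (\<lambda>x. x < m) (filter (\<lambda>x. k < x) w) = filter (\<lambda>x. k < x \<and> x < m) w"
      "filter (\<lambda>x. m < x) (filter (\<lambda>x. k < x) w) = filter (\<lambda>x. m < x) w" if "k < m" for m
      using that by (auto simp: filter_filter intro!: filter_cong)
    have "word_weight (Suc k) b (filter (\<lambda>x. k < x) (j # w)) = (\<Sum>m\<in>{m\<in>?S. k < m}.
        tent (Suc k) b j m * word_weight (Suc k) m (filter (\<lambda>x. k < x \<and> x < m) w) *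
          word_weight (Suc m) b (filter (\<lambda>x. m < x) w))"
      using \<open>k < j\<close> by (simp only: filter.simps if_True word_weight.simps S)
        (auto simp only: f intro!: sum.cong)
    moreover have "filter (\<lambda>x. x < k) (j # w) = filter (\<lambda>x. x < k) w" using \<open>k < j\<close> by simp
    moreover have "?r k m = tent a b i k * tent (Suc k) b j m" for m
      using \<open>k < j\<close> by (simp add: right_tent_def)
    ultimately have "tent a b i k * word_weight a k (filter (\<lambda>x. x < k) (j # w)) *
       word_weight (Suc k) b (filter (\<lambda>x. k < x) (j # w)) =
       (\<Sum>m\<in>{m\<in>?S. k < m}. ?r k m * ?T k m)"
      by (simp only: sum_distrib_left sum_distrib_right mult_ac)
    moreover have "(\<Sum>m\<in>{m\<in>?S. m < k}. ?l m k * ?T m k) = 0"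
      using \<open>k < j\<close> by (intro sum.neutral) (auto simp: left_tent_def)
    ultimately show ?thesis by simp
  qed
  have "word_weight a b (i # j # w) = (\<Sum>k\<in>?S - {j}.
      (\<Sum>m\<in>{m\<in>?S. m < k}. ?l m k * ?T m k) + (\<Sum>m\<in>{m\<in>?S. k < m}. ?r k m * ?T k m))"
    unfolding word_weight.simps(2)[of a b i] using *
    by (intro sum.cong) auto
  \<comment> \<open>The excluded root k = j may be added back: \<open>left_tent\<close> and
    \<open>right_tent\<close> vanish there by their strict inequalities.\<close>
  also have "\<dots> = (\<Sum>k\<in>?S.
      (\<Sum>m\<in>{m\<in>?S. m < k}. ?l m k * ?T m k) + (\<Sum>m\<in>{m\<in>?S. k < m}. ?r k m * ?T k m))"
    by (intro sum.mono_neutral_left)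
       (auto simp: left_tent_def right_tent_def intro!: sum.neutral)
  also have "\<dots> = (\<Sum>k\<in>?S. (\<Sum>m\<in>{m\<in>?S. k < m}. ?l k m * ?T k m)) +
      (\<Sum>k\<in>?S. (\<Sum>m\<in>{m\<in>?S. k < m}. ?r k m * ?T k m))"
    unfolding sum.distrib by (subst sum.swap_restrict) auto
  also have "\<dots> = (\<Sum>k\<in>?S. (\<Sum>m\<in>{m\<in>?S. k < m}. (?l k m + ?r k m) * ?T k m))"
    by (simp only: sum.distrib[symmetric] distrib_right)
  also have "\<dots> = (\<Sum>(p, q)\<in>?P. (?l p q + ?r p q) * ?T p q)"
    by (subst sum.Sigma) (auto intro!: sum.cong)
  finally show ?thesis .
qed

lemma word_weight_swap:
  assumes "i \<in> {a..<b}" "j \<in> {a..<b}"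
  shows "word_weight a b (i # j # w) = word_weight a b (j # i # w)"
  unfolding word_weight_Cons2[OF assms] word_weight_Cons2[OF assms(2,1)]
  using assms by (auto intro!: sum.cong tent_product_symmetric)

text \<open>The combinatorial counterpart of the equality of mixed partial derivatives.\<close>

lemma word_weight_mset_cong:
  assumes "mset w = mset w'" "set w \<subseteq> {a..<b}"
  shows "word_weight a b w = word_weight a b w'"
  using assms
proof (induction "length w" arbitrary: w w' a b rule: less_induct)
  case less
  have same: "word_weight a b (i # v) = word_weight a b (i # v')"
    if "length v < length w" "mset v = mset v'" "set v \<subseteq> {a..<b}" for i v v'
  proof -
    have "set v = set v'" using that(2) by (metis set_mset_mset)
    moreover have "word_weight a k (filter (\<lambda>j. j < k) v) = word_weight a k (filter (\<lambda>j. j < k) v')"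
      "word_weight (Suc k) b (filter (\<lambda>j. k < j) v) = word_weight (Suc k) b (filter (\<lambda>j. k < j) v')"
      for k
      using that by (auto intro!: less.hyps le_less_trans[OF length_filter_le] simp: mset_filter)
    ultimately show ?thesis by simp
  qed
  show ?case
  proof (cases w)
    case (Cons i v)
    with less.prems obtain j v' where w': "w' = j # v'" by (cases w') auto
    show ?thesis
    proof (cases "i = j")
      case False
      \<comment> \<open>If the first letters differ, both words are connected through
        \<open>i # j # m\<close> and \<open>j # i # m\<close>, where \<open>m\<close> is what
        remains after removing i and j. The outer links keep the first letter and are covered by
        \<open>same\<close>.\<close>
      obtain m where m: "mset m = mset v - {#j#}" by (metis ex_mset)
      have "add_mset i (mset v) = add_mset j (mset v')" using less.prems Cons w' by simp
      with False m have v: "mset v = mset (j # m)" and v': "mset (i # m) = mset v'"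
        by (auto simp: add_eq_conv_ex)
      have "set (j # m) = set v" "set (i # m) = set v'" using v v' by (metis set_mset_mset)+
      moreover have "set w = set w'" using less.prems by (metis set_mset_mset)
      ultimately have "set (i # m) \<subseteq> {a..<b}" "set v \<subseteq> {a..<b}"
         "i \<in> {a..<b}" "j \<in> {a..<b}"
        using less.prems Cons w' by auto
      moreover have "length (i # m) < length w"
        using v Cons by (metis length_Cons lessI size_mset)
      moreover have "length v < length w"
        using Cons by simp
      ultimately have "word_weight a b (i # v) = word_weight a b (i # j # m)"
         "word_weight a b (j # i # m) = word_weight a b (j # v')"
        using v v' by (blast intro: same)+
      with word_weight_swap \<open>i \<in> {a..<b}\<close> \<open>j \<in> {a..<b}\<close> Cons w' show ?thesis by metis
    next
      case True
      with less.prems Cons w' have "length v < length w" "mset v = mset v'" "set v \<subseteq> {a..<b}"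
        by auto
      from same[OF this] show ?thesis using True Cons w' by simp
    qed
  qed (use less.prems in auto)
qed

section \<open>The weight polynomial\<close>

text \<open>The factorials match the normalization of the mixed Eulerian numbers, and
  differentiation then removes one element of \<open>m\<close> without a numerical factor.\<close>

definition divided_power :: "'a multiset \<Rightarrow> ('a \<Rightarrow> real) \<Rightarrow> real"
  where "divided_power m u = (\<Prod>i\<in>set_mset m. u i ^ count m i / fact (count m i))"

lemma divided_power_superset:
  assumes "finite A" "set_mset m \<subseteq> A"
  shows "divided_power m u = (\<Prod>i\<in>A. u i ^ count m i / fact (count m i))"
  unfolding divided_power_def
  by (rule prod.mono_neutral_left) (use assms in \<open>auto simp: not_in_iff\<close>)

lemma divided_power_empty [simp]: "divided_power {#} u = 1"
  by (simp add: divided_power_def)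

lemma divided_power_add_disjoint:
  assumes "set_mset m \<inter> set_mset m' = {}"
  shows "divided_power (m + m') u = divided_power m u * divided_power m' u"
proof -
  have "count m' i = 0" if "i \<in># m" for i
    using assms that by (auto simp: count_eq_zero_iff)
  moreover have "count m i = 0" if "i \<in># m'" for i
    using assms that by (auto simp: count_eq_zero_iff)
  ultimately have "(\<Prod>i\<in>set_mset m. u i ^ count (m + m') i / fact (count (m + m') i)) = divided_power m u"
    "(\<Prod>i\<in>set_mset m'. u i ^ count (m + m') i / fact (count (m + m') i)) = divided_power m' u"
    unfolding divided_power_def
    by (auto intro!: prod.cong)
  then show ?thesis
    using assms by (simp add: divided_power_def prod.union_disjoint)
qed

lemma divided_power_cong:
  assumes "\<And>i. i \<in># m \<Longrightarrow> u i = u' i"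
  shows "divided_power m u = divided_power m u'"
  unfolding divided_power_def using assms by (intro prod.cong) auto

lemma divided_power_image_Suc:
  "divided_power (image_mset Suc m) u = divided_power m (u \<circ> Suc)"
proof -
  have c: "count (image_mset Suc m) (Suc i) = count m i" for i
    by (induction m) auto
  show ?thesis
    by (simp add: divided_power_def prod.reindex c)
qed

lemma divided_power_has_derivative:
  assumes "\<And>i. i \<in># m \<Longrightarrow> ((\<lambda>t. U t i) has_real_derivative U' i) (at t)"
  shows "((\<lambda>t. divided_power m (U t)) has_real_derivative
    (\<Sum>i\<in>set_mset m. U' i * divided_power (m - {#i#}) (U t))) (at t)"
proof -
  let ?f = "\<lambda>i t. U t i ^ count m i / fact (count m i)"
  let ?f' = "\<lambda>i. U' i * (U t i ^ (count m i - 1) / fact (count m i - 1))"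
  have "(?f i has_real_derivative ?f' i) (at t)" if "i \<in># m" for i
  proof -
    from that obtain c where "count m i = Suc c"
      by (metis count_eq_zero_iff not0_implies_Suc)
    moreover have "((\<lambda>t. U t i ^ Suc c / fact (Suc c)) has_real_derivative
        (1 + real c) * (U' i * U t i ^ c) / fact (Suc c)) (at t)"
      by (intro DERIV_cdivide DERIV_power_Suc assms that)
    moreover have "(1 + real c) * (U' i * U t i ^ c) / fact (Suc c) = U' i * (U t i ^ c / fact c)"
      by simp
    ultimately show ?thesis by simp
  qed
  from has_field_derivative_prod[of "set_mset m" ?f ?f', OF this]
  have "((\<lambda>t. divided_power m (U t)) has_real_derivative
    (\<Sum>i\<in>set_mset m. ?f' i * (\<Prod>j\<in>set_mset m - {i}. ?f j t))) (at t)"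
    by (simp add: divided_power_def)
  also have "(\<Sum>i\<in>set_mset m. ?f' i * (\<Prod>j\<in>set_mset m - {i}. ?f j t)) =
     (\<Sum>i\<in>set_mset m. U' i * divided_power (m - {#i#}) (U t))"
  proof (intro sum.cong refl)
    fix i assume "i \<in># m"
    have "divided_power (m - {#i#}) (U t) =
       (\<Prod>j\<in>set_mset m. U t j ^ count (m - {#i#}) j / fact (count (m - {#i#}) j))"
      by (rule divided_power_superset) (auto dest: in_diffD)
    also have "\<dots> = U t i ^ (count m i - 1) / fact (count m i - 1) * (\<Prod>j\<in>set_mset m - {i}. ?f j t)"
      using \<open>i \<in># m\<close>
      by (subst prod.remove[of _ i]) (auto intro!: arg_cong2[of _ _ _ _ times] prod.cong)
    finally show "?f' i * (\<Prod>j\<in>set_mset m - {i}. ?f j t) = U' i * divided_power (m - {#i#}) (U t)"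
      by simp
  qed
  finally show ?thesis .
qed

text \<open>Its coefficients do not depend on the chosen (sorted) ordering of \<open>m\<close>, by
  \<open>word_weight_mset_cong\<close>.\<close>

definition weight_poly :: "nat \<Rightarrow> nat \<Rightarrow> (nat \<Rightarrow> real) \<Rightarrow> real"
  where "weight_poly a b u = (\<Sum>m\<in>multisets_of_size {a..<b} (b - a).
    word_weight a b (sorted_list_of_multiset m) * divided_power m u)"

lemma weight_poly_empty: "b \<le> a \<Longrightarrow> weight_poly a b u = 1"
  by (simp add: weight_poly_def)

lemma weight_poly_cong:
  assumes "\<And>i. i \<in> {a..<b} \<Longrightarrow> u i = u' i"
  shows "weight_poly a b u = weight_poly a b u'"
  unfolding weight_poly_def using assms
  by (intro sum.cong refl arg_cong2[of _ _ _ _ times] divided_power_cong)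
     (auto dest!: multisets_of_size_subset)

lemma weight_poly_shift: "weight_poly (Suc a) (Suc b) u = weight_poly a b (u \<circ> Suc)"
proof -
  let ?M = "multisets_of_size {a..<b} (b - a)"
  let ?N = "multisets_of_size {Suc a..<Suc b} (Suc b - Suc a)"
  have "?N = image_mset Suc ` ?M"
  proof (intro equalityI subsetI)
    fix m assume m: "m \<in> ?N"
    then have sub: "set_mset m \<subseteq> {Suc a..<Suc b}" and size: "size m = b - a"
      by (auto simp: multisets_of_size_def)
    have "image_mset Suc (image_mset (\<lambda>i. i - 1) m) = m"
      unfolding image_mset.compositionality o_def
      by (rule multiset.map_ident_strong) (use sub in auto)
    moreover have "image_mset (\<lambda>i. i - 1) m \<in> ?M"
      using sub size by (fastforce simp: multisets_of_size_def)
    ultimately show "m \<in> image_mset Suc ` ?M" by (metis image_eqI)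
  qed (fastforce simp: multisets_of_size_def subset_eq)
  moreover have "inj_on (image_mset Suc) ?M"
    by (rule inj_on_subset[OF multiset.inj_map]) auto
  moreover have "word_weight (Suc a) (Suc b) (sorted_list_of_multiset (image_mset Suc m)) =
      word_weight a b (sorted_list_of_multiset m)" if "m \<in> ?M" for m
  proof -
    have "word_weight (Suc a) (Suc b) (sorted_list_of_multiset (image_mset Suc m)) =
        word_weight (Suc a) (Suc b) (map Suc (sorted_list_of_multiset m))"
      using that by (intro word_weight_mset_cong) (auto simp: multisets_of_size_def)
    then show ?thesis by (simp add: word_weight_shift)
  qed
  ultimately show ?thesis
    by (simp add: weight_poly_def sum.reindex divided_power_image_Suc)
qed

text \<open>The left side will be the partial derivative of \<open>weight_poly\<close> by
  \<open>u i\<close>. For a fixed root k, a multiset avoiding k is the sum of its parts below and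
  above k, and divided powers with disjoint supports multiply, so the sum factors.\<close>

lemma sum_weight_Cons:
  assumes "i \<in> {a..<b}"
  shows "(\<Sum>m\<in>multisets_of_size {a..<b} (b - Suc a).
      word_weight a b (i # sorted_list_of_multiset m) * divided_power m u) =
    (\<Sum>k\<in>{a..<b}. tent a b i k * weight_poly a k u * weight_poly (Suc k) b u)"
proof -
  let ?M = "multisets_of_size {a..<b} (b - Suc a)"
  let ?B = "\<lambda>a b m. word_weight a b (sorted_list_of_multiset m)"
  let ?g = "\<lambda>k m. tent a b i k *
     (?B a k {#j \<in># m. j < k#} * ?B (Suc k) b {#j \<in># m. k < j#} * divided_power m u)"
  have B: "word_weight c d (filter P (sorted_list_of_multiset m)) = ?B c d (filter_mset P m)"
    if "set_mset (filter_mset P m) \<subseteq> {c..<d}" for c d P m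
    using that by (intro word_weight_mset_cong) (auto simp: mset_filter)
  have "(\<Sum>m\<in>?M. word_weight a b (i # sorted_list_of_multiset m) * divided_power m u) =
     (\<Sum>m\<in>?M. \<Sum>k\<in>{k\<in>{a..<b}. k \<notin># m}. ?g k m)"
  proof (intro sum.cong refl)
    fix m assume "m \<in> ?M"
    then have "set_mset m \<subseteq> {a..<b}" by (rule multisets_of_size_subset)
    then have "word_weight a b (i # sorted_list_of_multiset m) = (\<Sum>k\<in>{a..<b} - set_mset m.
       tent a b i k * ?B a k {#j \<in># m. j < k#} * ?B (Suc k) b {#j \<in># m. k < j#})"
      unfolding word_weight.simps
      by (intro sum.cong arg_cong2[of _ _ _ _ times] refl B) auto
    moreover have "{a..<b} - set_mset m = {k\<in>{a..<b}. k \<notin># m}" by auto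
    ultimately show "word_weight a b (i # sorted_list_of_multiset m) * divided_power m u =
       (\<Sum>k\<in>{k\<in>{a..<b}. k \<notin># m}. ?g k m)"
      by (simp add: sum_distrib_right mult.assoc)
  qed
  also have "\<dots> = (\<Sum>k\<in>{a..<b}. \<Sum>m\<in>{m\<in>?M. k \<notin># m}. ?g k m)"
    by (rule sum.swap_restrict) (auto intro!: finite_multisets_of_size)
  also have "\<dots> = (\<Sum>k\<in>{a..<b}. tent a b i k * weight_poly a k u * weight_poly (Suc k) b u)"
  proof (rule sum.cong[OF refl])
    fix k assume k: "k \<in> {a..<b}"
    let ?M1 = "multisets_of_size {a..<k} (k - a)"
    let ?M2 = "multisets_of_size {Suc k..<b} (b - Suc k)"
    let ?S = "{m\<in>?M. k \<notin># m \<and> size {#j \<in># m. j < k#} = k - a}"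
    have split: "{#j \<in># m. j < k#} + {#j \<in># m. k < j#} = m" if "k \<notin># m" for m
    proof -
      have "{#j \<in># m. k < j#} = {#j \<in># m. \<not> j < k#}"
        using that by (intro filter_mset_cong) (auto, metis not_less_iff_gr_or_eq)
      then show ?thesis by simp
    qed
    \<comment> \<open>A multiset with the wrong number of elements below k contributes 0, by
      \<open>word_weight_eq_0\<close>.\<close>
    have "(\<Sum>m\<in>{m\<in>?M. k \<notin># m}. ?g k m) = (\<Sum>m\<in>?S. ?g k m)"
    proof (rule sum.mono_neutral_right)
      show "\<forall>m\<in>{m \<in> ?M. k \<notin># m} - ?S. ?g k m = 0"
        by (auto intro!: word_weight_eq_0)
           (metis size_mset mset_sorted_list_of_multiset)
    qed (auto intro!: finite_subset[OF _ finite_multisets_of_size])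
    also have "\<dots> = (\<Sum>(m1, m2)\<in>?M1 \<times> ?M2. tent a b i k *
       (?B a k m1 * ?B (Suc k) b m2 * (divided_power m1 u * divided_power m2 u)))"
    proof (rule sum.reindex_bij_witness[of _ "\<lambda>(m1, m2). m1 + m2"
         "\<lambda>m. ({#j \<in># m. j < k#}, {#j \<in># m. k < j#})"])
      fix m assume m: "m \<in> ?S"
      then have "size {#j \<in># m. j < k#} + size {#j \<in># m. k < j#} = b - Suc a"
        using split by (metis (no_types, lifting) mem_Collect_eq multisets_of_size_size size_union)
      with m k show "({#j \<in># m. j < k#}, {#j \<in># m. k < j#}) \<in> ?M1 \<times> ?M2"
        by (auto simp: multisets_of_size_def)
      show "(case ({#j \<in># m. j < k#}, {#j \<in># m. k < j#}) of (m1, m2) \<Rightarrow> m1 + m2) = m"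
        using m split by auto
      have "divided_power m u =
         divided_power {#j \<in># m. j < k#} u * divided_power {#j \<in># m. k < j#} u"
        using m by (subst split[symmetric]) (auto intro: divided_power_add_disjoint)
      then show "(case ({#j \<in># m. j < k#}, {#j \<in># m. k < j#}) of (m1, m2) \<Rightarrow> tent a b i k *
       (?B a k m1 * ?B (Suc k) b m2 * (divided_power m1 u * divided_power m2 u))) = ?g k m"
        by simp
    next
      fix mm assume "mm \<in> ?M1 \<times> ?M2"
      then obtain m1 m2 where mm: "mm = (m1, m2)" and m1: "set_mset m1 \<subseteq> {a..<k}" "size m1 = k - a"
         and m2: "set_mset m2 \<subseteq> {Suc k..<b}" "size m2 = b - Suc k"
        by (auto simp: multisets_of_size_def)
      have "filter_mset (\<lambda>j. j < k) m1 = m1" "filter_mset (\<lambda>j. j < k) m2 = {#}"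
        "filter_mset (\<lambda>j. k < j) m2 = m2" "filter_mset (\<lambda>j. k < j) m1 = {#}"
        using m1(1) m2(1) by (fastforce simp: filter_mset_eq_conv filter_mset_eq_mempty_iff subset_eq)+
      moreover have "k \<notin># m1 + m2" "size (m1 + m2) = b - Suc a" "set_mset (m1 + m2) \<subseteq> {a..<b}"
        using m1 m2 k by auto
      ultimately show "(case mm of (m1, m2) \<Rightarrow> m1 + m2) \<in> ?S"
        "({#j \<in># case mm of (m1, m2) \<Rightarrow> m1 + m2. j < k#},
          {#j \<in># case mm of (m1, m2) \<Rightarrow> m1 + m2. k < j#}) = mm"
        using m1 mm by (auto simp: multisets_of_size_def)
    qed
    also have "\<dots> = tent a b i k * weight_poly a k u * weight_poly (Suc k) b u"
      unfolding weight_poly_def mult.assoc sum_product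
      by (simp add: sum.cartesian_product[symmetric] sum_distrib_left mult_ac)
    finally show "(\<Sum>m\<in>{m\<in>?M. k \<notin># m}. ?g k m) = \<dots>" .
  qed
  finally show ?thesis .
qed

text \<open>Stated along a curve, so that one chain rule serves the substitution of differences, the
  scaling behind Euler's identity, and the variation of a single entry.\<close>

lemma weight_poly_has_derivative:
  assumes "\<And>i. i \<in> {a..<b} \<Longrightarrow> ((\<lambda>t. U t i) has_real_derivative U' i) (at t)"
  shows "((\<lambda>t. weight_poly a b (U t)) has_real_derivative
    (\<Sum>i\<in>{a..<b}. U' i * (\<Sum>k\<in>{a..<b}.
       tent a b i k * weight_poly a k (U t) * weight_poly (Suc k) b (U t)))) (at t)"
proof -
  let ?M = "multisets_of_size {a..<b} (b - a)"
  let ?M' = "multisets_of_size {a..<b} (b - Suc a)"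
  let ?B = "\<lambda>m. word_weight a b (sorted_list_of_multiset m)"
  have fin: "finite ?M" by (intro finite_multisets_of_size) auto
  have "((\<lambda>t. weight_poly a b (U t)) has_real_derivative
    (\<Sum>m\<in>?M. ?B m * (\<Sum>i\<in>set_mset m. U' i * divided_power (m - {#i#}) (U t)))) (at t)"
    unfolding weight_poly_def
    by (intro DERIV_sum DERIV_cmult divided_power_has_derivative assms)
       (use multisets_of_size_subset in blast)
  also have "(\<Sum>m\<in>?M. ?B m * (\<Sum>i\<in>set_mset m. U' i * divided_power (m - {#i#}) (U t))) =
     (\<Sum>m\<in>?M. \<Sum>i\<in>{i\<in>{a..<b}. i \<in># m}. ?B m * (U' i * divided_power (m - {#i#}) (U t)))"
  proof (intro sum.cong refl)
    fix m assume "m \<in> ?M"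
    then have "{i\<in>{a..<b}. i \<in># m} = set_mset m" by (auto dest!: multisets_of_size_subset)
    then show "?B m * (\<Sum>i\<in>set_mset m. U' i * divided_power (m - {#i#}) (U t)) =
       (\<Sum>i\<in>{i\<in>{a..<b}. i \<in># m}. ?B m * (U' i * divided_power (m - {#i#}) (U t)))"
      by (simp add: sum_distrib_left)
  qed
  also have "\<dots> = (\<Sum>i\<in>{a..<b}. \<Sum>m\<in>{m\<in>?M. i \<in># m}. ?B m * (U' i * divided_power (m - {#i#}) (U t)))"
    using fin by (intro sum.swap_restrict) auto
  also have "\<dots> = (\<Sum>i\<in>{a..<b}. \<Sum>m\<in>?M'.
      word_weight a b (i # sorted_list_of_multiset m) * (U' i * divided_power m (U t)))"
  proof (rule sum.cong[OF refl])
    fix i assume i: "i \<in> {a..<b}"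
    then have "a < b" by auto
    show "(\<Sum>m\<in>{m\<in>?M. i \<in># m}. ?B m * (U' i * divided_power (m - {#i#}) (U t))) =
       (\<Sum>m\<in>?M'. word_weight a b (i # sorted_list_of_multiset m) * (U' i * divided_power m (U t)))"
    proof (rule sum.reindex_bij_witness[of _ "add_mset i" "\<lambda>m. m - {#i#}"])
      fix m assume "m \<in> {m\<in>?M. i \<in># m}"
      then have m: "set_mset m \<subseteq> {a..<b}" "size m = b - a" "i \<in># m"
        by (auto simp: multisets_of_size_def)
      show "add_mset i (m - {#i#}) = m" using m by simp
      show "m - {#i#} \<in> ?M'"
        using m by (auto simp: multisets_of_size_def size_Diff_singleton dest: in_diffD)
      \<comment> \<open>Order independence enters here: the letter removed by differentiation is
        moved to the front, where it is read by the root.\<close>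
      have "word_weight a b (i # sorted_list_of_multiset (m - {#i#})) = ?B m"
        using m i by (intro word_weight_mset_cong) (auto dest: in_diffD)
      then show "word_weight a b (i # sorted_list_of_multiset (m - {#i#})) *
          (U' i * divided_power (m - {#i#}) (U t)) = ?B m * (U' i * divided_power (m - {#i#}) (U t))"
        by simp
    next
      fix m assume "m \<in> ?M'"
      then show "add_mset i m \<in> {m\<in>?M. i \<in># m}" "add_mset i m - {#i#} = m"
        using i \<open>a < b\<close> by (auto simp: multisets_of_size_def)
    qed
  qed
  also have "\<dots> = (\<Sum>i\<in>{a..<b}. U' i * (\<Sum>m\<in>?M'.
      word_weight a b (i # sorted_list_of_multiset m) * divided_power m (U t)))"
    by (simp add: sum_distrib_left mult_ac)
  also have "\<dots> = (\<Sum>i\<in>{a..<b}. U' i * (\<Sum>k\<in>{a..<b}.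
       tent a b i k * weight_poly a k (U t) * weight_poly (Suc k) b (U t)))"
    by (intro sum.cong refl arg_cong2[of _ _ _ _ times] sum_weight_Cons)
  finally show ?thesis .
qed

section \<open>The weight polynomial in the vertex coordinates\<close>

lemma divided_power_scale:
  "divided_power m (\<lambda>i. t * u i) = t ^ size m * divided_power m u"
  by (simp add: divided_power_def power_mult_distrib prod.distrib power_sum
      size_multiset_overloaded_eq flip: times_divide_eq_right)

lemma weight_poly_scale:
  "weight_poly a b (\<lambda>i. t * u i) = t ^ (b - a) * weight_poly a b u"
  unfolding weight_poly_def sum_distrib_left
  by (intro sum.cong refl) (auto simp: divided_power_scale multisets_of_size_def)

lemma continuous_on_weight_poly:
  assumes "\<And>i. continuous_on S (\<lambda>s. U s i)"
  shows "continuous_on S (\<lambda>s. weight_poly a b (U s))"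
  unfolding weight_poly_def divided_power_def
  by (intro continuous_intros assms) auto

text \<open>The future volume of the permutohedron with entries \<open>x a\<close>, ...,
  \<open>x b\<close>; these are b - a + 1 entries, so the dimension is b - a.\<close>

definition vol_poly :: "nat \<Rightarrow> nat \<Rightarrow> (nat \<Rightarrow> real) \<Rightarrow> real"
  where "vol_poly a b x = fact (b - a) * weight_poly a b (\<lambda>i. x i - x (Suc i))"

lemma vol_poly_self [simp]: "vol_poly a a x = 1"
  by (simp add: vol_poly_def weight_poly_empty)

lemma vol_poly_cong:
  assumes "\<And>i. i \<in> {a..b} \<Longrightarrow> x i = y i"
  shows "vol_poly a b x = vol_poly a b y"
  unfolding vol_poly_def
  by (intro arg_cong2[of _ _ _ _ times] refl weight_poly_cong) (use assms in auto)

lemma vol_poly_shift: "vol_poly (Suc a) (Suc b) x = vol_poly a b (x \<circ> Suc)"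
  by (simp add: vol_poly_def weight_poly_shift o_def)

lemma continuous_on_vol_poly:
  assumes "\<And>i. continuous_on S (\<lambda>s. X s i)"
  shows "continuous_on S (\<lambda>s. vol_poly a b (X s))"
  unfolding vol_poly_def by (intro continuous_intros continuous_on_weight_poly assms)

text \<open>Summation by parts gives the slopes 1 / (k - a + 1) and -1 / (b - k) of the tent;
  multiplied by (b - a)! / ((k - a)! (b - k - 1)!) they become these binomials.\<close>

definition vol_coeff :: "nat \<Rightarrow> nat \<Rightarrow> nat \<Rightarrow> nat \<Rightarrow> real"
  where "vol_coeff a b j k =
    (if j \<le> k then real ((b - a) choose Suc (k - a)) else - real ((b - a) choose (k - a)))"

definition vol_deriv :: "nat \<Rightarrow> nat \<Rightarrow> nat \<Rightarrow> (nat \<Rightarrow> real) \<Rightarrow> real"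
  where "vol_deriv a b j x =
    (\<Sum>k\<in>{a..<b}. vol_coeff a b j k * (vol_poly a k x * vol_poly (Suc k) b x))"

lemma sum_parts_left:
  fixes Y :: "nat \<Rightarrow> real"
  assumes "a \<le> k"
  shows "(\<Sum>i\<in>{a..k}. (Y i - Y (Suc i)) * (real i - real a + 1)) =
    (\<Sum>j\<in>{a..k}. Y j) - (real k - real a + 1) * Y (Suc k)"
  using assms by (induction k rule: dec_induct) (simp_all add: algebra_simps)

lemma sum_parts_right:
  fixes Y :: "nat \<Rightarrow> real"
  assumes "m \<le> b"
  shows "(\<Sum>i\<in>{m..<b}. (Y i - Y (Suc i)) * (real b - real i)) =
    (real b - real m) * Y m - (\<Sum>j\<in>{Suc m..b}. Y j)"
  using assms
proof (induction m rule: inc_induct)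
  case (step m)
  then have "{m..<b} = insert m {Suc m..<b}" "{Suc m..b} = insert (Suc m) {Suc (Suc m)..b}"
    by auto
  with step show ?case by (simp add: algebra_simps)
qed simp

text \<open>Summation by parts: \<open>Y j\<close> is multiplied by the increment of the tent from j
  - 1 to j. There are no boundary terms because the tent vanishes at a - 1 and at b.\<close>

lemma sum_parts_tent:
  fixes Y :: "nat \<Rightarrow> real"
  assumes "a \<le> k" "k < b"
  shows "(\<Sum>i\<in>{a..<b}. (Y i - Y (Suc i)) * tent a b i k) =
    (\<Sum>j\<in>{a..b}. Y j * (if j \<le> k then 1 / (real k - real a + 1) else - 1 / (real b - real k)))"
proof -
  let ?p = "real k - real a + 1" and ?q = "real b - real k"
  have pq: "?p > 0" "?q > 0" using assms by auto
  have split: "{a..<b} = {a..k} \<union> {Suc k..<b}" using assms by auto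
  have "(\<Sum>i\<in>{a..<b}. (Y i - Y (Suc i)) * tent a b i k) =
    (\<Sum>i\<in>{a..k}. (Y i - Y (Suc i)) * tent a b i k) +
    (\<Sum>i\<in>{Suc k..<b}. (Y i - Y (Suc i)) * tent a b i k)"
    unfolding split by (rule sum.union_disjoint) auto
  also have "(\<Sum>i\<in>{a..k}. (Y i - Y (Suc i)) * tent a b i k) =
     (\<Sum>i\<in>{a..k}. (Y i - Y (Suc i)) * (real i - real a + 1)) / ?p"
    unfolding sum_divide_distrib by (rule sum.cong) (use assms in \<open>auto simp: tent_eq_left_part\<close>)
  also have "(\<Sum>i\<in>{Suc k..<b}. (Y i - Y (Suc i)) * tent a b i k) =
     (\<Sum>i\<in>{Suc k..<b}. (Y i - Y (Suc i)) * (real b - real i)) / ?q"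
    unfolding sum_divide_distrib by (rule sum.cong) (use assms in \<open>auto simp: tent_eq_right_part\<close>)
  also have "(\<Sum>i\<in>{a..k}. (Y i - Y (Suc i)) * (real i - real a + 1)) / ?p =
     (\<Sum>j\<in>{a..k}. Y j) / ?p - Y (Suc k)"
    using assms pq by (subst sum_parts_left) (auto simp: diff_divide_distrib)
  also have "(\<Sum>i\<in>{Suc k..<b}. (Y i - Y (Suc i)) * (real b - real i)) / ?q =
     Y (Suc k) - (\<Sum>j\<in>{Suc k..b}. Y j) / ?q"
  proof -
    have "{Suc k..b} = insert (Suc k) {Suc (Suc k)..b}" using assms by auto
    then have "(\<Sum>i\<in>{Suc k..<b}. (Y i - Y (Suc i)) * (real b - real i)) =
       ?q * Y (Suc k) - (\<Sum>j\<in>{Suc k..b}. Y j)"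
      using assms by (subst sum_parts_right) (auto simp: algebra_simps)
    then show ?thesis using pq by (simp add: diff_divide_distrib)
  qed
  also have "(\<Sum>j\<in>{a..k}. Y j) / ?p - Y (Suc k) + (Y (Suc k) - (\<Sum>j\<in>{Suc k..b}. Y j) / ?q) =
    (\<Sum>j\<in>{a..k}. Y j * (if j \<le> k then 1 / ?p else - 1 / ?q)) +
    (\<Sum>j\<in>{Suc k..b}. Y j * (if j \<le> k then 1 / ?p else - 1 / ?q))"
    by (simp add: sum_divide_distrib flip: sum_negf)
  also have "\<dots> = (\<Sum>j\<in>{a..k} \<union> {Suc k..b}. Y j * (if j \<le> k then 1 / ?p else - 1 / ?q))"
    by (rule sum.union_disjoint[symmetric]) auto
  also have "{a..k} \<union> {Suc k..b} = {a..b}" using assms by auto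
  finally show ?thesis .
qed

lemma vol_coeff_eq:
  assumes "a \<le> k" "k < b"
  shows "fact (b - a) * (if j \<le> k then 1 / (real k - real a + 1) else - 1 / (real b - real k)) =
    vol_coeff a b j k * (fact (k - a) * fact (b - Suc k))"
proof -
  have "real k - real a + 1 = real (Suc (k - a))" "real b - real k = real (Suc (b - Suc k))"
    using assms by auto
  moreover have "b - a - Suc (k - a) = b - Suc k" "b - a - (k - a) = Suc (b - Suc k)"
    using assms by auto
  then have "real ((b - a) choose Suc (k - a)) = fact (b - a) / (fact (Suc (k - a)) * fact (b - Suc k))"
    "real ((b - a) choose (k - a)) = fact (b - a) / (fact (k - a) * fact (Suc (b - Suc k)))"
    using assms by (auto simp: binomial_fact simp del: fact_Suc)
  ultimately show ?thesis
    by (auto simp: vol_coeff_def simp del: of_nat_Suc)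
qed

lemma vol_poly_has_derivative:
  assumes "a \<le> b" "\<And>i. i \<in> {a..b} \<Longrightarrow> ((\<lambda>t. X t i) has_real_derivative X' i) (at t)"
  shows "((\<lambda>t. vol_poly a b (X t)) has_real_derivative
    (\<Sum>j\<in>{a..b}. X' j * vol_deriv a b j (X t))) (at t)"
proof -
  let ?q = "\<lambda>k. weight_poly a k (\<lambda>i. X t i - X t (Suc i)) * weight_poly (Suc k) b (\<lambda>i. X t i - X t (Suc i))"
  have "((\<lambda>t. vol_poly a b (X t)) has_real_derivative
    fact (b - a) * (\<Sum>i\<in>{a..<b}. (X' i - X' (Suc i)) * (\<Sum>k\<in>{a..<b}.
       tent a b i k * weight_poly a k (\<lambda>i. X t i - X t (Suc i)) *
         weight_poly (Suc k) b (\<lambda>i. X t i - X t (Suc i))))) (at t)"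
    unfolding vol_poly_def
    by (intro DERIV_cmult weight_poly_has_derivative DERIV_diff assms) auto
  also have "fact (b - a) * (\<Sum>i\<in>{a..<b}. (X' i - X' (Suc i)) * (\<Sum>k\<in>{a..<b}.
       tent a b i k * weight_poly a k (\<lambda>i. X t i - X t (Suc i)) *
         weight_poly (Suc k) b (\<lambda>i. X t i - X t (Suc i)))) =
     (\<Sum>i\<in>{a..<b}. \<Sum>k\<in>{a..<b}. fact (b - a) * ?q k * ((X' i - X' (Suc i)) * tent a b i k))"
    by (simp add: sum_distrib_left mult_ac)
  also have "\<dots> = (\<Sum>k\<in>{a..<b}. fact (b - a) * ?q k * (\<Sum>i\<in>{a..<b}. (X' i - X' (Suc i)) * tent a b i k))"
    by (subst sum.swap) (simp add: sum_distrib_left)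
  also have "\<dots> = (\<Sum>k\<in>{a..<b}. \<Sum>j\<in>{a..b}. X' j * (vol_coeff a b j k *
     (vol_poly a k (X t) * vol_poly (Suc k) b (X t))))"
  proof (rule sum.cong[OF refl])
    fix k assume "k \<in> {a..<b}"
    then have k: "a \<le> k" "k < b" by auto
    have "fact (b - a) * ?q k * (\<Sum>i\<in>{a..<b}. (X' i - X' (Suc i)) * tent a b i k) =
      (\<Sum>j\<in>{a..b}. X' j * ?q k * (fact (b - a) * (if j \<le> k then 1 / (real k - real a + 1) else - 1 / (real b - real k))))"
      unfolding sum_parts_tent[OF k] sum_distrib_left by (intro sum.cong refl) simp
    also have "\<dots> = (\<Sum>j\<in>{a..b}. X' j * (vol_coeff a b j k *
     (vol_poly a k (X t) * vol_poly (Suc k) b (X t))))"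
      unfolding vol_coeff_eq[OF k] by (simp add: vol_poly_def mult_ac)
    finally show "fact (b - a) * ?q k * (\<Sum>i\<in>{a..<b}. (X' i - X' (Suc i)) * tent a b i k) = \<dots>" .
  qed
  also have "\<dots> = (\<Sum>j\<in>{a..b}. X' j * vol_deriv a b j (X t))"
    unfolding vol_deriv_def sum_distrib_left by (rule sum.swap)
  finally show ?thesis .
qed

lemma vol_poly_euler:
  assumes "a \<le> b"
  shows "(\<Sum>j\<in>{a..b}. x j * vol_deriv a b j x) = real (b - a) * vol_poly a b x"
proof -
  have "((\<lambda>t. vol_poly a b (\<lambda>j. t * x j)) has_real_derivative
     (\<Sum>j\<in>{a..b}. x j * vol_deriv a b j (\<lambda>j. 1 * x j))) (at 1)"
    by (rule vol_poly_has_derivative[OF assms]) (auto intro!: derivative_eq_intros)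
  moreover have "vol_poly a b (\<lambda>j. t * x j) = t ^ (b - a) * vol_poly a b x" for t
    by (simp add: vol_poly_def weight_poly_scale flip: right_diff_distrib)
  then have "((\<lambda>t. vol_poly a b (\<lambda>j. t * x j)) has_real_derivative
     real (b - a) * vol_poly a b x) (at 1)"
    by (auto intro!: derivative_eq_intros)
  ultimately show ?thesis by (auto dest: DERIV_unique)
qed

section \<open>Merging two neighbouring entries\<close>

definition merge_at :: "nat \<Rightarrow> real \<Rightarrow> (nat \<Rightarrow> real) \<Rightarrow> nat \<Rightarrow> real"
  where "merge_at k s x = (\<lambda>i. if i < k then x i else if i = k then s else x (Suc i))"

definition skip :: "nat \<Rightarrow> (nat \<Rightarrow> real) \<Rightarrow> nat \<Rightarrow> real"
  where "skip m x = (\<lambda>i. if i < m then x i else x (Suc i))"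

text \<open>At an end of the integration range the merged entry equals one of the two entries it
  replaces, and the other one disappears. Thus the upper end for k and the lower end for k + 1 give
  the same vector.\<close>

lemma merge_at_endpoints:
  "merge_at k (x k) x = skip (Suc k) x" "merge_at k (x (Suc k)) x = skip k x"
  by (auto simp: merge_at_def skip_def fun_eq_iff less_Suc_eq)

lemma continuous_on_merge_at: "continuous_on S (\<lambda>s. merge_at k s x i)"
  by (cases "i = k"; cases "i < k") (auto simp: merge_at_def)

lemmas continuous_on_vol_poly_merge = continuous_on_vol_poly[OF continuous_on_merge_at]

text \<open>In a product of \<open>vol_poly a m\<close> and \<open>vol_poly (Suc m) b\<close> only
  one index range contains k. The other factor is constant in s and leaves the integral, unchanged
  here and with shifted indices in the next lemma.\<close>

lemma vol_poly_merge_below: "b < k \<Longrightarrow> vol_poly a b (merge_at k s x) = vol_poly a b x"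
  by (rule vol_poly_cong) (auto simp: merge_at_def)

lemma vol_poly_merge_above: "k < a \<Longrightarrow> vol_poly a b (merge_at k s x) = vol_poly (Suc a) (Suc b) x"
  unfolding vol_poly_shift by (rule vol_poly_cong) (auto simp: merge_at_def)

lemma vol_poly_merge_has_derivative:
  assumes "k \<in> {a..b}"
  shows "((\<lambda>s. vol_poly a b (merge_at k s x)) has_real_derivative
    vol_deriv a b k (merge_at k s x)) (at s)"
proof -
  have "((\<lambda>s. vol_poly a b (merge_at k s x)) has_real_derivative
    (\<Sum>j\<in>{a..b}. (if j = k then 1 else 0) * vol_deriv a b j (merge_at k s x))) (at s)"
  proof (rule vol_poly_has_derivative)
    fix i
    show "((\<lambda>s. merge_at k s x i) has_real_derivative (if i = k then 1 else 0)) (at s)"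
      by (cases "i = k"; cases "i < k") (auto simp: merge_at_def)
  qed (use assms in auto)
  also have "(\<Sum>j\<in>{a..b}. (if j = k then 1 else 0) * vol_deriv a b j (merge_at k s x)) =
    vol_deriv a b k (merge_at k s x)"
    using assms by (simp add: if_distrib[of "\<lambda>c. c * _"] cong: if_cong)
  finally show ?thesis .
qed

text \<open>Pascal's rule in both branches of \<open>vol_coeff\<close>. The cases m = a and m = b
  carry the values the binomials take where an index leaves the range \<open>{a..<b}\<close> of
  \<open>vol_deriv\<close>; they become the boundary terms of the recursion.\<close>

lemma vol_coeff_pascal:
  assumes "a \<le> m" "m \<le> b" "a \<le> j" "j \<le> Suc b"
  shows "vol_coeff a (Suc b) j m =
     (if m = a then (if j = a then 1 else 0) else vol_coeff a b (j - 1) (m - 1)) +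
     (if m = b then (if j = Suc b then - 1 else 0) else vol_coeff a b j m)"
proof -
  define d n where "d = m - a" and "n = b - a"
  with assms have m: "m = a + d" and b: "b = a + n" and "d \<le> n" by auto
  have n: "Suc (a + n) - a = Suc n" by simp
  show ?thesis
  proof (cases d)
    case 0
    then show ?thesis
      using assms unfolding m b by (auto simp: vol_coeff_def n)
  next
    case (Suc d')
    show ?thesis
      using assms \<open>d \<le> n\<close> unfolding m b by (cases "d = n") (auto simp: vol_coeff_def n Suc)
  qed
qed

text \<open>Euler's identity under the integral supplies the factor b - a, and integrating the
  derivative of s times the integrand supplies one more; the integrals of s times the derivative
  cancel. The index map sends an entry of x to its place in the merged vector, so that k and k + 1
  share a place.\<close>

lemma integral_merge_by_parts:
  assumes "k \<in> {a..b}" "x (Suc k) \<le> x k"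
  defines "D \<equiv> \<lambda>p. integral {x (Suc k)..x k} (\<lambda>s. vol_deriv a b p (merge_at k s x))"
  shows "real (Suc b - a) * integral {x (Suc k)..x k} (\<lambda>s. vol_poly a b (merge_at k s x)) =
    x k * vol_poly a b (skip k x) - x (Suc k) * vol_poly a b (skip (Suc k) x) +
      (\<Sum>j\<in>{a..Suc b}. x j * D (if j \<le> k then j else j - 1))"
proof -
  let ?I = "{x (Suc k)..x k}"
  let ?h = "\<lambda>s. vol_poly a b (merge_at k s x)" and ?d = "\<lambda>p s. vol_deriv a b p (merge_at k s x)"
  let ?y = "\<lambda>p. if p < k then x p else x (Suc p)"
  have contd: "continuous_on S (?d p)" for p S
    unfolding vol_deriv_def by (intro continuous_intros continuous_on_vol_poly_merge)
  have conth: "continuous_on S ?h" for S by (rule continuous_on_vol_poly_merge)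
  have hk: "?h (x k) = vol_poly a b (skip (Suc k) x)" "?h (x (Suc k)) = vol_poly a b (skip k x)"
    by (simp_all add: merge_at_endpoints)
  have dh: "(?h has_real_derivative ?d k s) (at s)" for s
    by (rule vol_poly_merge_has_derivative[OF assms(1)])
  have "(?d k has_integral (?h (x k) - ?h (x (Suc k)))) ?I"
    by (intro fundamental_theorem_of_calculus assms)
       (auto simp flip: has_real_derivative_iff_has_vector_derivative intro: dh has_field_derivative_at_within)
  \<comment> \<open>Integration by parts leaves \<open>x k\<close> and \<open>x (Suc k)\<close>
    paired with the wrong vectors for telescoping. Adding \<open>(x k + x (Suc k)) * D k\<close>,
    the share of the two merged entries in the final sum, exchanges the vectors.\<close>
  then have Dk: "D k = vol_poly a b (skip (Suc k) x) - vol_poly a b (skip k x)"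
    unfolding D_def hk by (rule integral_unique)
  have "((\<lambda>s. ?h s + s * ?d k s) has_integral (x k * ?h (x k) - x (Suc k) * ?h (x (Suc k)))) ?I"
    by (intro fundamental_theorem_of_calculus assms)
       (auto simp flip: has_real_derivative_iff_has_vector_derivative
         intro!: derivative_eq_intros has_field_derivative_at_within[OF dh])
  then have "x k * ?h (x k) - x (Suc k) * ?h (x (Suc k)) = integral ?I (\<lambda>s. ?h s + s * ?d k s)"
    by (simp add: integral_unique)
  also have "\<dots> = integral ?I ?h + integral ?I (\<lambda>s. s * ?d k s)"
    by (intro integral_add integrable_continuous_real continuous_intros conth contd)
  finally have parts: "x k * vol_poly a b (skip (Suc k) x) - x (Suc k) * vol_poly a b (skip k x) =
      integral ?I ?h + integral ?I (\<lambda>s. s * ?d k s)"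
    unfolding hk .
  have "real (b - a) * integral ?I ?h = integral ?I (\<lambda>s. real (b - a) * ?h s)"
    by simp
  also have "\<dots> = integral ?I (\<lambda>s. s * ?d k s + (\<Sum>p\<in>{a..b} - {k}. ?y p * ?d p s))"
  proof (rule integral_cong)
    fix s
    have "real (b - a) * ?h s = (\<Sum>p\<in>{a..b}. merge_at k s x p * ?d p s)"
      using assms(1) by (subst vol_poly_euler) auto
    also have "\<dots> = s * ?d k s + (\<Sum>p\<in>{a..b} - {k}. merge_at k s x p * ?d p s)"
      using assms(1) by (subst sum.remove[of _ k]) (auto simp: merge_at_def)
    also have "(\<Sum>p\<in>{a..b} - {k}. merge_at k s x p * ?d p s) = (\<Sum>p\<in>{a..b} - {k}. ?y p * ?d p s)"
      by (rule sum.cong) (auto simp: merge_at_def)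
    finally show "real (b - a) * ?h s = s * ?d k s + (\<Sum>p\<in>{a..b} - {k}. ?y p * ?d p s)" .
  qed
  also have "\<dots> = integral ?I (\<lambda>s. s * ?d k s) + integral ?I (\<lambda>s. (\<Sum>p\<in>{a..b} - {k}. ?y p * ?d p s))"
    by (intro integral_add integrable_continuous_real continuous_intros contd)
  also have "integral ?I (\<lambda>s. (\<Sum>p\<in>{a..b} - {k}. ?y p * ?d p s)) = (\<Sum>p\<in>{a..b} - {k}. ?y p * D p)"
    unfolding D_def
    by (subst integral_sum) (auto intro!: integrable_continuous_real continuous_intros contd)
  finally have euler: "real (b - a) * integral ?I ?h =
      integral ?I (\<lambda>s. s * ?d k s) + (\<Sum>p\<in>{a..b} - {k}. ?y p * D p)" .
  have split: "{a..Suc b} = {a..k} \<union> {Suc k..Suc b}" using assms(1) by auto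
  have "(\<Sum>j\<in>{a..Suc b}. x j * D (if j \<le> k then j else j - 1)) =
     (\<Sum>j\<in>{a..k}. x j * D (if j \<le> k then j else j - 1)) +
     (\<Sum>j\<in>{Suc k..Suc b}. x j * D (if j \<le> k then j else j - 1))"
    unfolding split by (rule sum.union_disjoint) auto
  also have "(\<Sum>j\<in>{a..k}. x j * D (if j \<le> k then j else j - 1)) = x k * D k + (\<Sum>j\<in>{a..<k}. ?y j * D j)"
    using assms(1) by (subst sum.remove[of _ k]) (auto intro!: sum.cong)
  also have "(\<Sum>j\<in>{Suc k..Suc b}. x j * D (if j \<le> k then j else j - 1)) = (\<Sum>j\<in>{k..b}. x (Suc j) * D j)"
    by (subst sum.shift_bounds_cl_Suc_ivl) (auto intro!: sum.cong)
  also have "\<dots> = x (Suc k) * D k + (\<Sum>j\<in>{Suc k..b}. ?y j * D j)"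
    using assms(1) by (subst sum.remove[of _ k]) (auto intro!: sum.cong)
  finally have "(\<Sum>j\<in>{a..Suc b}. x j * D (if j \<le> k then j else j - 1)) =
     (x k + x (Suc k)) * D k + ((\<Sum>j\<in>{a..<k}. ?y j * D j) + (\<Sum>j\<in>{Suc k..b}. ?y j * D j))"
    by (simp add: algebra_simps)
  also have "(\<Sum>j\<in>{a..<k}. ?y j * D j) + (\<Sum>j\<in>{Suc k..b}. ?y j * D j) = (\<Sum>p\<in>{a..b} - {k}. ?y p * D p)"
    using assms(1) by (subst sum.union_disjoint[symmetric]) (auto intro!: sum.cong)
  finally have "(\<Sum>j\<in>{a..Suc b}. x j * D (if j \<le> k then j else j - 1)) =
     (x k + x (Suc k)) * D k + (\<Sum>p\<in>{a..b} - {k}. ?y p * D p)" .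
  moreover have "real (Suc b - a) = 1 + real (b - a)" using assms(1) by auto
  ultimately show ?thesis
    using parts euler unfolding Dk by (simp add: algebra_simps)
qed

text \<open>Both sides are compared after multiplication by their degree. For the integrals this is done
  by \<open>integral_merge_by_parts\<close>, whose boundary terms telescope over \<open>k\<close>; the remaining integrals
  of partial derivatives factor into products to which the induction hypothesis applies.\<close>

lemma vol_poly_recursion:
  assumes "a \<le> b" "\<And>i. i \<in> {a..b} \<Longrightarrow> x (Suc i) \<le> x i"
  shows "vol_poly a (Suc b) x =
    (\<Sum>k\<in>{a..b}. integral {x (Suc k)..x k} (\<lambda>s. vol_poly a b (merge_at k s x)))"
  using assms
proof (induction "b - a" arbitrary: a b rule: less_induct)
  case less
  let ?I = "\<lambda>k f. integral {x (Suc k)..x k} (\<lambda>s. f (merge_at k s x))"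
  let ?W = "\<lambda>m. vol_poly a b (skip m x)"
  let ?pos = "\<lambda>k j. if j \<le> k then j else j - 1"
  let ?T = "\<lambda>m. vol_poly a m x * vol_poly (Suc m) (Suc b) x"
  \<comment> \<open>The formula that differentiating the recursion by \<open>x j\<close> would
    suggest. The integrals with k = j and k = j - 1 supply the endpoint terms; at j = a and j =
    \<open>Suc b\<close> one of the two is absent, hence the corrections.\<close>
  have sum_D: "(\<Sum>k\<in>{a..b}. ?I k (vol_deriv a b (?pos k j))) =
      vol_deriv a (Suc b) j x - (if j = a then ?W a else 0) + (if j = Suc b then ?W (Suc b) else 0)"
    if j: "j \<in> {a..Suc b}" for j
  proof -
    let ?A = "\<lambda>k m. vol_coeff a b (j - 1) m * vol_poly (Suc (Suc m)) (Suc b) x * ?I k (vol_poly a m)"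
    let ?B = "\<lambda>k m. vol_coeff a b j m * vol_poly a m x * ?I k (vol_poly (Suc m) b)"
    have "?I k (vol_deriv a b (?pos k j)) = (\<Sum>m\<in>{m\<in>{a..<b}. k \<le> m}. ?A k m) + (\<Sum>m\<in>{m\<in>{a..<b}. m < k}. ?B k m)"
      if k: "k \<in> {a..b}" for k
    proof -
      have "?I k (vol_deriv a b (?pos k j)) = (\<Sum>m\<in>{a..<b}. integral {x (Suc k)..x k} (\<lambda>s.
         vol_coeff a b (?pos k j) m * (vol_poly a m (merge_at k s x) * vol_poly (Suc m) b (merge_at k s x))))"
        unfolding vol_deriv_def
        by (rule integral_sum)
           (auto intro!: integrable_continuous_real continuous_intros continuous_on_vol_poly_merge)
      \<comment> \<open>For k <= m the merged entry lies in the first factor and the second is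
        shifted; otherwise it lies in the second. The coefficient depends on k only through the same
        comparison, so the sums over k below are instances of the induction hypothesis.\<close>
      also have "\<dots> = (\<Sum>m\<in>{a..<b}. if k \<le> m then ?A k m else ?B k m)"
      proof (intro sum.cong refl)
        fix m
        have c: "vol_coeff a b (?pos k j) m = (if k \<le> m then vol_coeff a b (j - 1) m else vol_coeff a b j m)"
          by (auto simp: vol_coeff_def)
        show "integral {x (Suc k)..x k} (\<lambda>s.
           vol_coeff a b (?pos k j) m * (vol_poly a m (merge_at k s x) * vol_poly (Suc m) b (merge_at k s x))) =
           (if k \<le> m then ?A k m else ?B k m)"
          unfolding c by (auto simp: vol_poly_merge_above vol_poly_merge_below mult_ac)
      qed
      also have "\<dots> = (\<Sum>m\<in>{a..<b} \<inter> {m. k \<le> m}. ?A k m) + (\<Sum>m\<in>{a..<b} \<inter> - {m. k \<le> m}. ?B k m)"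
        by (rule sum.If_cases) auto
      finally show ?thesis by (simp add: Int_def Compl_eq not_le)
    qed
    then have "(\<Sum>k\<in>{a..b}. ?I k (vol_deriv a b (?pos k j))) =
      (\<Sum>k\<in>{a..b}. \<Sum>m\<in>{m\<in>{a..<b}. k \<le> m}. ?A k m) + (\<Sum>k\<in>{a..b}. \<Sum>m\<in>{m\<in>{a..<b}. m < k}. ?B k m)"
      by (simp only: sum.distrib[symmetric] cong: sum.cong)
    also have "(\<Sum>k\<in>{a..b}. \<Sum>m\<in>{m\<in>{a..<b}. k \<le> m}. ?A k m) = (\<Sum>m\<in>{a..<b}. \<Sum>k\<in>{k\<in>{a..b}. k \<le> m}. ?A k m)"
      by (rule sum.swap_restrict) auto
    also have "\<dots> = (\<Sum>m\<in>{a..<b}. vol_coeff a b (j - 1) m * ?T (Suc m))"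
    proof (rule sum.cong[OF refl])
      fix m assume m: "m \<in> {a..<b}"
      then have "{k\<in>{a..b}. k \<le> m} = {a..m}" by auto
      moreover have "vol_poly a (Suc m) x = (\<Sum>k\<in>{a..m}. ?I k (vol_poly a m))"
        by (rule less.hyps) (use m less.prems in auto)
      ultimately show "(\<Sum>k\<in>{k\<in>{a..b}. k \<le> m}. ?A k m) = vol_coeff a b (j - 1) m * ?T (Suc m)"
        by (simp add: sum_distrib_left mult_ac)
    qed
    also have "\<dots> = (\<Sum>m\<in>{Suc a..b}. vol_coeff a b (j - 1) (m - 1) * ?T m)"
      by (rule sum.reindex_bij_witness[of _ "\<lambda>m. m - 1" Suc]) auto
    also have "\<dots> = (\<Sum>m\<in>{a..b}. (if m = a then (if j = a then 1 else 0) else vol_coeff a b (j - 1) (m - 1)) * ?T m)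
        - (if j = a then ?T a else 0)"
    proof -
      have "{a..b} = insert a {Suc a..b}" using less.prems(1) by auto
      then show ?thesis by (auto intro!: sum.cong)
    qed
    also have "(\<Sum>k\<in>{a..b}. \<Sum>m\<in>{m\<in>{a..<b}. m < k}. ?B k m) = (\<Sum>m\<in>{a..<b}. \<Sum>k\<in>{k\<in>{a..b}. m < k}. ?B k m)"
      by (rule sum.swap_restrict) auto
    also have "\<dots> = (\<Sum>m\<in>{a..<b}. vol_coeff a b j m * ?T m)"
    proof (rule sum.cong[OF refl])
      fix m assume m: "m \<in> {a..<b}"
      then have "{k\<in>{a..b}. m < k} = {Suc m..b}" by auto
      moreover have "vol_poly (Suc m) (Suc b) x = (\<Sum>k\<in>{Suc m..b}. ?I k (vol_poly (Suc m) b))"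
        by (rule less.hyps) (use m less.prems in auto)
      ultimately show "(\<Sum>k\<in>{k\<in>{a..b}. m < k}. ?B k m) = vol_coeff a b j m * ?T m"
        by (simp add: sum_distrib_left mult_ac)
    qed
    also have "\<dots> = (\<Sum>m\<in>{a..b}. (if m = b then (if j = Suc b then - 1 else 0) else vol_coeff a b j m) * ?T m)
        + (if j = Suc b then ?T b else 0)"
    proof -
      have "{a..b} = insert b {a..<b}" using less.prems(1) by auto
      then show ?thesis by (auto intro!: sum.cong)
    qed
    finally have "(\<Sum>k\<in>{a..b}. ?I k (vol_deriv a b (?pos k j))) =
       (\<Sum>m\<in>{a..b}. vol_coeff a (Suc b) j m * ?T m) - (if j = a then ?T a else 0) + (if j = Suc b then ?T b else 0)"
      using j by (simp add: vol_coeff_pascal distrib_right sum.distrib)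
    also have "(\<Sum>m\<in>{a..b}. vol_coeff a (Suc b) j m * ?T m) = vol_deriv a (Suc b) j x"
      unfolding vol_deriv_def by (simp add: atLeastLessThanSuc_atLeastAtMost)
    also have "?T a = ?W a"
      by (simp add: vol_poly_shift) (rule vol_poly_cong, auto simp: skip_def)
    also have "?T b = ?W (Suc b)"
      by simp (rule vol_poly_cong, auto simp: skip_def)
    finally show ?thesis .
  qed
  have "real (Suc b - a) * (\<Sum>k\<in>{a..b}. ?I k (vol_poly a b)) =
     (\<Sum>k\<in>{a..b}. (x k * ?W k - x (Suc k) * ?W (Suc k)) + (\<Sum>j\<in>{a..Suc b}. x j * ?I k (vol_deriv a b (?pos k j))))"
    unfolding sum_distrib_left using less.prems by (intro sum.cong refl integral_merge_by_parts) auto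
  also have "\<dots> = (\<Sum>k\<in>{a..b}. x k * ?W k - x (Suc k) * ?W (Suc k)) +
     (\<Sum>j\<in>{a..Suc b}. x j * (\<Sum>k\<in>{a..b}. ?I k (vol_deriv a b (?pos k j))))"
    unfolding sum.distrib sum_distrib_left by (subst sum.swap) (rule refl)
  \<comment> \<open>What survives the telescoping cancels against the corrections at j = a and j =
    \<open>Suc b\<close> in \<open>sum_D\<close>.\<close>
  also have "(\<Sum>k\<in>{a..b}. x k * ?W k - x (Suc k) * ?W (Suc k)) = x a * ?W a - x (Suc b) * ?W (Suc b)"
    using sum_Suc_diff[of a b "\<lambda>k. - (x k * ?W k)"] less.prems(1) by simp
  also have "(\<Sum>j\<in>{a..Suc b}. x j * (\<Sum>k\<in>{a..b}. ?I k (vol_deriv a b (?pos k j)))) =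
     (\<Sum>j\<in>{a..Suc b}. x j * vol_deriv a (Suc b) j x - (if j = a then x a * ?W a else 0) +
       (if j = Suc b then x (Suc b) * ?W (Suc b) else 0))"
    by (intro sum.cong refl) (simp add: sum_D algebra_simps)
  also have "\<dots> = (\<Sum>j\<in>{a..Suc b}. x j * vol_deriv a (Suc b) j x) - x a * ?W a + x (Suc b) * ?W (Suc b)"
    using less.prems(1) by (simp only: sum.distrib sum_subtractf) simp
  also have "(\<Sum>j\<in>{a..Suc b}. x j * vol_deriv a (Suc b) j x) = real (Suc b - a) * vol_poly a (Suc b) x"
    using less.prems(1) by (intro vol_poly_euler) auto
  finally show ?case using less.prems(1) by simp
qed

section \<open>Slicing permutohedra\<close>

definition prefix_sum :: "(nat \<Rightarrow> real) \<Rightarrow> nat \<Rightarrow> real"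
  where "prefix_sum x m = (\<Sum>i\<in>{1..m}. x i)"

lemma prefix_sum_0 [simp]: "prefix_sum x 0 = 0"
  by (simp add: prefix_sum_def)

lemma prefix_sum_Suc [simp]: "prefix_sum x (Suc m) = prefix_sum x m + x (Suc m)"
  by (simp add: prefix_sum_def)

lemma decreasing_bracket:
  fixes x :: "nat \<Rightarrow> real"
  assumes "a \<le> b" "x (Suc b) \<le> s" "s \<le> x a"
  obtains k where "k \<in> {a..b}" "x (Suc k) \<le> s" "s \<le> x k"
  using assms
proof (induction b arbitrary: thesis rule: dec_induct)
  case (step b)
  show ?case
  proof (cases "s \<le> x (Suc b)")
    case True
    with step.prems(1)[of "Suc b"] step.prems(2,3) step.hyps(1) show ?thesis by auto
  next
    case False
    with step obtain k where "k \<in> {a..b}" "x (Suc k) \<le> s" "s \<le> x k" by force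
    with step.prems(1)[of k] show ?thesis by auto
  qed
qed auto

lemma decreasing_le:
  fixes x :: "nat \<Rightarrow> real"
  assumes "\<And>i. i \<in> {a..b} \<Longrightarrow> x (Suc i) \<le> x i" "a \<le> i" "i \<le> j" "j \<le> Suc b"
  shows "x j \<le> x i"
  using assms(3,4)
proof (induction j rule: dec_induct)
  case (step j)
  then show ?case using assms(1)[of j] assms(2) by auto
qed auto

lemma merge_at_decreasing:
  assumes "\<And>i. i \<in> {1..Suc n} \<Longrightarrow> x (Suc i) \<le> x i" "k \<in> {1..Suc n}" "x (Suc k) \<le> s" "s \<le> x k" "i \<in> {1..n}"
  shows "merge_at k s x (Suc i) \<le> merge_at k s x i"
proof -
  have "x (Suc k) \<le> x i" if "i < k"
    by (rule decreasing_le[where a = 1 and b = "Suc n" and x = x, OF assms(1)]) (use that assms(2-) in auto)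
  moreover have "x k \<le> x i" if "i < k"
    by (rule decreasing_le[where a = 1 and b = "Suc n" and x = x, OF assms(1)]) (use that assms(2-) in auto)
  ultimately show ?thesis
    using assms(1)[of i] assms(1)[of "Suc i"] assms(2-5)
    by (cases i k rule: linorder_cases) (auto simp: merge_at_def)
qed

lemma prefix_sum_merge_at:
  assumes "1 \<le> k"
  shows "prefix_sum (merge_at k (x k + x (Suc k) - s) x) m =
    (if m < k then prefix_sum x m else prefix_sum x (Suc m) - s)"
proof (induction m)
  case (Suc m)
  consider "Suc m < k" | "k = Suc m" | "k < Suc m" by linarith
  then show ?case
    by cases (use Suc in \<open>auto simp: merge_at_def\<close>)
qed (use assms in auto)

text \<open>The second term of the minimum is the smaller one exactly when \<open>x (Suc m)\<close>
  <= s. As x decreases and s lies between its entries k + 1 and k, the minimum switches at m =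
  k.\<close>

lemma prefix_sum_merge_at_min:
  assumes "\<And>i. i \<in> {1..Suc n} \<Longrightarrow> x (Suc i) \<le> x i" "k \<in> {1..Suc n}" "x (Suc k) \<le> s" "s \<le> x k" "m \<le> Suc n"
  shows "prefix_sum (merge_at k (x k + x (Suc k) - s) x) m =
    min (prefix_sum x m) (prefix_sum x (Suc m) - s)"
proof (cases "m < k")
  case True
  then have "x k \<le> x (Suc m)"
    by (intro decreasing_le[where a = 1 and b = "Suc n" and x = x, OF assms(1)]) (use assms(2-) in auto)
  with True assms(2-) show ?thesis by (simp add: prefix_sum_merge_at)
next
  case False
  then have "x (Suc m) \<le> x (Suc k)"
    by (intro decreasing_le[where a = 1 and b = "Suc n" and x = x, OF assms(1)]) (use assms(2-) in auto)
  with False assms(2-) show ?thesis by (simp add: prefix_sum_merge_at)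
qed

text \<open>The coordinate n + 1 is eliminated through the fixed total: the upper bound for a set
  containing n + 1 becomes the lower bound for its complement.\<close>

definition projected_permutohedron :: "nat \<Rightarrow> (nat \<Rightarrow> real) \<Rightarrow> (nat \<Rightarrow> real) set"
  where "projected_permutohedron n x = {t \<in> {1..n} \<rightarrow>\<^sub>E UNIV. \<forall>I\<in>Pow {1..n}.
    prefix_sum x (Suc n) - prefix_sum x (Suc n - card I) \<le> sum t I \<and> sum t I \<le> prefix_sum x (card I)}"

lemma Pow_atLeastAtMost_Suc:
  "(\<forall>I\<in>Pow {1..Suc n}. P I) \<longleftrightarrow> (\<forall>I\<in>Pow {1..n}. P I \<and> P (insert (Suc n) I))"
proof -
  have "{1..Suc n} = insert (Suc n) {1..n}" by auto
  then show ?thesis by (auto simp: Pow_insert)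
qed

text \<open>Once the last coordinate is s, the constraints for I and for I with \<open>Suc n\<close>
  added bound the same sum. The tighter upper bound is the minimum of
  \<open>prefix_sum_merge_at_min\<close>, and the lower bounds combine likewise.\<close>

lemma projected_permutohedron_slice:
  assumes "\<And>i. i \<in> {1..Suc n} \<Longrightarrow> x (Suc i) \<le> x i" "k \<in> {1..Suc n}" "x (Suc k) \<le> s" "s \<le> x k"
    and t: "t \<in> {1..n} \<rightarrow>\<^sub>E UNIV"
  shows "t(Suc n := s) \<in> projected_permutohedron (Suc n) x \<longleftrightarrow>
    t \<in> projected_permutohedron n (merge_at k (x k + x (Suc k) - s) x)"
proof -
  let ?y = "merge_at k (x k + x (Suc k) - s) x"
  note y = prefix_sum_merge_at_min[OF assms(1-4)]
  have "t(Suc n := s) \<in> {1..Suc n} \<rightarrow>\<^sub>E UNIV"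
    using t by (auto simp: PiE_def extensional_def)
  moreover have "prefix_sum x (Suc (Suc n)) - prefix_sum x (Suc (Suc n) - card I) \<le> sum (t(Suc n := s)) I \<and>
     sum (t(Suc n := s)) I \<le> prefix_sum x (card I) \<and>
     prefix_sum x (Suc (Suc n)) - prefix_sum x (Suc (Suc n) - card (insert (Suc n) I)) \<le> sum (t(Suc n := s)) (insert (Suc n) I) \<and>
     sum (t(Suc n := s)) (insert (Suc n) I) \<le> prefix_sum x (card (insert (Suc n) I)) \<longleftrightarrow>
     prefix_sum ?y (Suc n) - prefix_sum ?y (Suc n - card I) \<le> sum t I \<and> sum t I \<le> prefix_sum ?y (card I)"
    if "I \<in> Pow {1..n}" for I
  proof -
    from that have I: "finite I" "Suc n \<notin> I" "card I \<le> n"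
      using card_mono[of "{1..n}" I] finite_subset[of I "{1..n}"] by auto
    then have eqs: "sum (t(Suc n := s)) I = sum t I" "sum (t(Suc n := s)) (insert (Suc n) I) = s + sum t I"
      "card (insert (Suc n) I) = Suc (card I)" "Suc (Suc n) - card I = Suc (Suc n - card I)"
      by (auto intro!: sum.cong)
    have "prefix_sum ?y (Suc n) = prefix_sum x (Suc (Suc n)) - s"
      using assms(2) by (subst prefix_sum_merge_at) auto
    moreover have "prefix_sum ?y (Suc n - card I) =
        min (prefix_sum x (Suc n - card I)) (prefix_sum x (Suc (Suc n - card I)) - s)"
      "prefix_sum ?y (card I) = min (prefix_sum x (card I)) (prefix_sum x (Suc (card I)) - s)"
      using I by (auto intro!: y simp del: prefix_sum_Suc)
    ultimately show ?thesis
      unfolding eqs diff_Suc_Suc min_def by (smt (verit))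
  qed
  ultimately show ?thesis
    using t unfolding projected_permutohedron_def mem_Collect_eq Pow_atLeastAtMost_Suc by simp
qed

lemma projected_permutohedron_last_coordinate:
  assumes "t(Suc n := s) \<in> projected_permutohedron (Suc n) x"
  shows "x (Suc (Suc n)) \<le> s" "s \<le> x 1"
proof -
  have "{Suc n} \<in> Pow {1..Suc n}" by auto
  with assms show "x (Suc (Suc n)) \<le> s" "s \<le> x 1"
    unfolding projected_permutohedron_def by force+
qed

section \<open>Volume of the permutohedron by Fubini\<close>

lemma sets_projected_permutohedron:
  "projected_permutohedron n x \<in> sets (PiM {1..n} (\<lambda>_. lborel))"
proof -
  let ?M = "PiM {1..n} (\<lambda>_. lborel :: real measure)"
  have "projected_permutohedron n x = {t \<in> space ?M. \<forall>I\<in>Pow {1..n}.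
    prefix_sum x (Suc n) - prefix_sum x (Suc n - card I) \<le> sum t I \<and> sum t I \<le> prefix_sum x (card I)}"
    by (auto simp: projected_permutohedron_def space_PiM)
  also have "\<dots> \<in> sets ?M"
  proof (rule sets.sets_Collect_finite_All')
    fix I assume "I \<in> Pow {1..n}"
    then have [measurable]: "(\<lambda>t. sum t I) \<in> borel_measurable ?M"
      by (intro borel_measurable_sum measurable_component_singleton[THEN measurable_compose]) auto
    show "{t \<in> space ?M. prefix_sum x (Suc n) - prefix_sum x (Suc n - card I) \<le> sum t I \<and>
       sum t I \<le> prefix_sum x (card I)} \<in> sets ?M"
      by measurable
  qed auto
  finally show ?thesis .
qed

text \<open>The section at height s has the merged entry \<open>x k + x (Suc k) - s\<close>, whereas
  the recursion integrates over the merged entry itself; a reflection of the interval relates the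
  two.\<close>

lemma has_integral_reflect_interval:
  fixes f :: "real \<Rightarrow> real"
  assumes "(f has_integral I) {a..b}"
  shows "((\<lambda>s. f (b + a - s)) has_integral I) {a..b}"
proof (cases "a \<le> b")
  case True
  with has_integral_affinity[of f I a b "-1" "b + a"] assms show ?thesis
    by (simp add: image_affinity_atLeastAtMost algebra_simps)
qed (use assms in auto)

lemma has_integral_combine_decreasing:
  fixes x :: "nat \<Rightarrow> real" and f :: "real \<Rightarrow> real"
  assumes "a \<le> b" "\<And>k. k \<in> {a..b} \<Longrightarrow> x (Suc k) \<le> x k"
    and "\<And>k. k \<in> {a..b} \<Longrightarrow> (f has_integral I k) {x (Suc k)..x k}"
  shows "(f has_integral (\<Sum>k\<in>{a..b}. I k)) {x (Suc b)..x a}"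
  using assms
proof (induction b rule: dec_induct)
  case (step b)
  have "x (Suc b) \<le> x a"
    by (rule decreasing_le[of a "Suc b"]) (use step.prems step.hyps in auto)
  moreover have "(f has_integral (\<Sum>k\<in>{a..b}. I k)) {x (Suc b)..x a}"
    using step by auto
  ultimately have "(f has_integral (I (Suc b) + (\<Sum>k\<in>{a..b}. I k))) {x (Suc (Suc b))..x a}"
    using step.prems step.hyps by (intro has_integral_combine[of _ "x (Suc b)"]) auto
  then show ?case
    using step.hyps by (simp add: add.commute)
qed simp

text \<open>Nonnegativity is part of the induction because \<open>ennreal\<close> sends negative
  reals to 0, while the step needs the real measure of each section to equal the polynomial.\<close>

lemma emeasure_projected_permutohedron:
  assumes "\<And>i. i \<in> {1..n} \<Longrightarrow> x (Suc i) \<le> x i"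
  shows "emeasure (PiM {1..n} (\<lambda>_. lborel)) (projected_permutohedron n x) =
    ennreal (vol_poly 1 (Suc n) x) \<and> 0 \<le> vol_poly 1 (Suc n) x"
  using assms
proof (induction n arbitrary: x)
  case 0
  have "projected_permutohedron 0 x = {\<lambda>_. undefined}"
    by (auto simp: projected_permutohedron_def)
  then show ?case by (simp add: PiM_empty)
next
  case (Suc n)
  interpret product_sigma_finite "\<lambda>_ :: nat. lborel :: real measure"
    by standard
  let ?P = "projected_permutohedron (Suc n) x"
  let ?M = "PiM {1..n} (\<lambda>_. lborel :: real measure)"
  let ?y = "\<lambda>k s. merge_at k (x k + x (Suc k) - s) x"
  let ?slice = "\<lambda>s. {t \<in> {1..n} \<rightarrow>\<^sub>E UNIV. t(Suc n := s) \<in> ?P}"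
  let ?I = "\<lambda>k. integral {x (Suc k)..x k} (\<lambda>s. vol_poly 1 (Suc n) (merge_at k s x))"
  have slice: "emeasure ?M (?slice s) = ennreal (vol_poly 1 (Suc n) (?y k s))"
     "0 \<le> vol_poly 1 (Suc n) (?y k s)"
    if "k \<in> {1..Suc n}" "x (Suc k) \<le> s" "s \<le> x k" for k s
  proof -
    have "?slice s = projected_permutohedron n (?y k s)"
      using projected_permutohedron_slice[OF Suc.prems that]
      by (auto simp: projected_permutohedron_def)
    moreover have dec: "?y k s (Suc i) \<le> ?y k s i" if "i \<in> {1..n}" for i
      by (rule merge_at_decreasing[of n])
         (use Suc.prems that \<open>k \<in> {1..Suc n}\<close> \<open>x (Suc k) \<le> s\<close> \<open>s \<le> x k\<close> in auto)
    have "emeasure ?M (projected_permutohedron n (?y k s)) = ennreal (vol_poly 1 (Suc n) (?y k s)) \<and>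
        0 \<le> vol_poly 1 (Suc n) (?y k s)"
      by (rule Suc.IH) (rule dec)
    ultimately show "emeasure ?M (?slice s) = ennreal (vol_poly 1 (Suc n) (?y k s))"
     "0 \<le> vol_poly 1 (Suc n) (?y k s)" by auto
  qed
  let ?\<Omega> = "{x (Suc (Suc n))..x 1}"
  have int: "((\<lambda>s. measure ?M (?slice s)) has_integral ?I k) {x (Suc k)..x k}" if "k \<in> {1..Suc n}" for k
  proof -
    have "((\<lambda>s. vol_poly 1 (Suc n) (merge_at k s x)) has_integral ?I k) {x (Suc k)..x k}"
      by (intro integrable_integral integrable_continuous_real continuous_on_vol_poly_merge)
    then have "((\<lambda>s. vol_poly 1 (Suc n) (?y k s)) has_integral ?I k) {x (Suc k)..x k}"
      by (rule has_integral_reflect_interval)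
    moreover have "vol_poly 1 (Suc n) (?y k s) = measure ?M (?slice s)" if "s \<in> {x (Suc k)..x k}" for s
      using slice[of k s] \<open>k \<in> {1..Suc n}\<close> that by (auto simp: measure_def)
    ultimately show ?thesis by (rule has_integral_eq[rotated])
  qed
  have "((\<lambda>s. measure ?M (?slice s)) has_integral (\<Sum>k\<in>{1..Suc n}. ?I k)) ?\<Omega>"
    by (rule has_integral_combine_decreasing) (use int Suc.prems in auto)
  moreover have rec: "(\<Sum>k\<in>{1..Suc n}. ?I k) = vol_poly 1 (Suc (Suc n)) x"
    by (rule vol_poly_recursion[symmetric]) (use Suc.prems in auto)
  ultimately have total: "((\<lambda>s. measure ?M (?slice s)) has_integral vol_poly 1 (Suc (Suc n)) x) ?\<Omega>"
    by (simp only:)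
  have "emeasure (PiM {1..Suc n} (\<lambda>_. lborel)) ?P =
     (\<integral>\<^sup>+t. indicator ?P t \<partial>PiM (insert (Suc n) {1..n}) (\<lambda>_. lborel))"
    using sets_projected_permutohedron[of "Suc n" x]
    by (simp add: atLeastAtMostSuc_conv)
  also have "\<dots> = (\<integral>\<^sup>+s. (\<integral>\<^sup>+t. indicator ?P (t(Suc n := s)) \<partial>?M) \<partial>lborel)"
    by (rule product_nn_integral_insert_rev)
       (use sets_projected_permutohedron[of "Suc n" x] in \<open>auto simp: atLeastAtMostSuc_conv\<close>)
  also have "\<dots> = (\<integral>\<^sup>+s. ennreal (indicator ?\<Omega> s * measure ?M (?slice s)) \<partial>lborel)"
  proof (rule nn_integral_cong)
    fix s
    have "(\<integral>\<^sup>+t. indicator ?P (t(Suc n := s)) \<partial>?M) = (\<integral>\<^sup>+t. indicator (?slice s) t \<partial>?M)"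
      by (rule nn_integral_cong) (auto simp: space_PiM indicator_def)
    also have "\<dots> = ennreal (indicator ?\<Omega> s * measure ?M (?slice s))"
    proof (cases "s \<in> ?\<Omega>")
      case True
      then obtain k where k: "k \<in> {1..Suc n}" "x (Suc k) \<le> s" "s \<le> x k"
        by (auto elim: decreasing_bracket[of 1 "Suc n" x s, rotated])
      have "?slice s = projected_permutohedron n (?y k s)"
        using projected_permutohedron_slice[OF Suc.prems k]
        by (auto simp: projected_permutohedron_def)
      then have "?slice s \<in> sets ?M"
        using sets_projected_permutohedron[of n "?y k s"] by (simp only:)
      then show ?thesis using slice[OF k] True by (auto simp: measure_def)
    next
      case False
      then have "?slice s = {}" using projected_permutohedron_last_coordinate[of _ n s x] by auto
      then show ?thesis using False by simp
    qed
    finally show "(\<integral>\<^sup>+t. indicator ?P (t(Suc n := s)) \<partial>?M) =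
      ennreal (indicator ?\<Omega> s * measure ?M (?slice s))" .
  qed
  also have "\<dots> = ennreal (vol_poly 1 (Suc (Suc n)) x)"
    by (rule nn_integral_has_integral_lebesgue[OF _ total]) simp
  finally show ?case
    using has_integral_nonneg[OF total] by simp
qed

section \<open>Hypersimplices\<close>

lemma sum_fun_apply: "(\<Sum>i\<in>A. f i) x = (\<Sum>i\<in>A. f i x)"
  by (induction A rule: infinite_finite_induct) auto

lemma hypersimplex_coordinates:
  assumes "t \<in> hypersimplex k m"
  shows "0 \<le> t i" "t i \<le> 1" "i \<notin> {1..m} \<Longrightarrow> t i = 0" "(\<Sum>i\<in>{1..m}. t i) = real k"
proof -
  let ?C = "{t :: nat \<Rightarrow> real. (\<forall>i. 0 \<le> t i) \<and> (\<forall>i. t i \<le> 1) \<and> (\<forall>i. i \<notin> {1..m} \<longrightarrow> t i = 0) \<and>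
     (\<Sum>i\<in>{1..m}. t i) = real k}"
  have "hypersimplex k m \<subseteq> ?C"
    unfolding hypersimplex_def
  proof (rule hull_minimal)
    show "{t. (\<forall>i. t i \<in> {0, 1}) \<and> (\<forall>i. i \<notin> {1..m} \<longrightarrow> t i = 0) \<and>
       card {i \<in> {1..m}. t i = 1} = k} \<subseteq> ?C"
    proof (intro subsetI)
      fix t :: "nat \<Rightarrow> real"
      assume t: "t \<in> {t. (\<forall>i. t i \<in> {0, 1}) \<and> (\<forall>i. i \<notin> {1..m} \<longrightarrow> t i = 0) \<and>
         card {i \<in> {1..m}. t i = 1} = k}"
      then have "t i = (if t i = 1 then 1 else 0)" for i by auto
      then have "(\<Sum>i\<in>{1..m}. t i) = (\<Sum>i\<in>{1..m}. if t i = 1 then 1 else 0)"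
        by (intro sum.cong refl)
      also have "\<dots> = real (card {i \<in> {1..m}. t i = 1})"
        by (simp add: sum.If_cases Int_def)
      finally have "(\<Sum>i\<in>{1..m}. t i) = real k" using t by simp
      moreover have "0 \<le> t i \<and> t i \<le> 1" for i
        using t by (auto dest: spec[of _ i])
      ultimately show "t \<in> ?C" using t by auto
    qed
    show "convex ?C"
    proof (rule convexI)
      fix t t' :: "nat \<Rightarrow> real" and c d :: real
      assume t: "t \<in> ?C" "t' \<in> ?C" and cd: "0 \<le> c" "0 \<le> d" "c + d = 1"
      have "c * t i + d * t' i \<le> 1" for i
        using t cd by (intro convex_bound_le) auto
      moreover have "(\<Sum>i\<in>{1..m}. c * t i + d * t' i) = real k"
        using t cd by (simp add: sum.distrib flip: sum_distrib_left distrib_right)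
      ultimately show "c *\<^sub>R t + d *\<^sub>R t' \<in> ?C"
        using t cd by (simp add: scaleR_fun_def)
    qed
  qed
  then show "0 \<le> t i" "t i \<le> 1" "i \<notin> {1..m} \<Longrightarrow> t i = 0" "(\<Sum>i\<in>{1..m}. t i) = real k"
    using assms by auto
qed

lemma hypersimplex_mono: "hypersimplex k m \<subseteq> hypersimplex k (Suc m)"
proof -
  have "{i \<in> {1..Suc m}. t i = 1} = {i \<in> {1..m}. t i = 1}"
    if "t (Suc m) = 0" for t :: "nat \<Rightarrow> real"
    using that by (auto simp: le_Suc_eq)
  then show ?thesis unfolding hypersimplex_def by (intro hull_mono) auto
qed

text \<open>Convex hulls commute with translations, so it is enough to treat the vertices.\<close>

lemma hypersimplex_append:
  assumes "t \<in> hypersimplex k m"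
  shows "indicator {Suc m} + t \<in> hypersimplex (Suc k) (Suc m)"
proof -
  let ?V = "\<lambda>k m. {t :: nat \<Rightarrow> real. (\<forall>i. t i \<in> {0, 1}) \<and> (\<forall>i. i \<notin> {1..m} \<longrightarrow> t i = 0) \<and>
       card {i \<in> {1..m}. t i = 1} = k}"
  have "(+) (indicator {Suc m}) ` ?V k m \<subseteq> ?V (Suc k) (Suc m)"
  proof (intro subsetI)
    fix t' :: "nat \<Rightarrow> real" assume "t' \<in> (+) (indicator {Suc m}) ` ?V k m"
    then obtain t where t': "t' = indicator {Suc m} + t" and t: "t \<in> ?V k m" by blast
    have "{i \<in> {1..Suc m}. t' i = 1} = insert (Suc m) {i \<in> {1..m}. t i = 1}"
      using t unfolding t' by (auto simp: indicator_def le_Suc_eq)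
    moreover have "t' i \<in> {0, 1}" for i
      using t unfolding t' by (cases "i = Suc m") (auto simp: indicator_def)
    ultimately show "t' \<in> ?V (Suc k) (Suc m)"
      using t unfolding t' by (auto simp: indicator_def)
  qed
  then have "convex hull ((+) (indicator {Suc m}) ` ?V k m) \<subseteq> hypersimplex (Suc k) (Suc m)"
    unfolding hypersimplex_def by (rule hull_mono)
  then show ?thesis
    using assms unfolding convex_hull_translation hypersimplex_def by blast
qed

lemma zero_in_hypersimplex: "0 \<in> hypersimplex 0 m"
  unfolding hypersimplex_def by (rule hull_inc) auto

text \<open>Convexity without a division in the statement: the total weight will be
  \<open>x k - x (Suc k)\<close>, which may be 0.\<close>

lemma convex_cone_combination:
  fixes a b :: real
  assumes "convex C" "y \<in> C" "z \<in> C" "0 \<le> a" "0 \<le> b"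
  obtains w where "w \<in> C" "a *\<^sub>R y + b *\<^sub>R z = (a + b) *\<^sub>R w"
proof (cases "a + b = 0")
  case True
  with assms that[of y] show ?thesis by (simp add: add_nonneg_eq_0_iff)
next
  case False
  let ?w = "(a / (a + b)) *\<^sub>R y + (b / (a + b)) *\<^sub>R z"
  have "?w \<in> C"
    using assms False by (intro convexD) (auto simp flip: add_divide_distrib)
  moreover have "a *\<^sub>R y + b *\<^sub>R z = (a + b) *\<^sub>R ?w"
    using False by (simp add: scaleR_add_right)
  ultimately show ?thesis by (rule that)
qed

text \<open>The hyperplane section \<open>t (N + 1) = s\<close> of the permutohedron is again a permutohedron, whose
  decomposition into hypersimplices is turned into one of the original point by appending a
  coordinate 0 or 1 to each summand.\<close>

lemma permutohedron_decomposition: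
  assumes "N \<ge> 1" "\<And>i. i \<ge> 1 \<Longrightarrow> x (Suc i) \<le> x i" "\<And>i. i > N \<Longrightarrow> x i = 0"
    and "\<And>I. I \<subseteq> {1..N} \<Longrightarrow> sum T I \<le> prefix_sum x (card I)"
    and "sum T {1..N} = prefix_sum x N"
    and "\<And>i. i \<notin> {1..N} \<Longrightarrow> T i = 0"
  shows "\<exists>p. (\<forall>m\<in>{1..N}. p m \<in> hypersimplex m N) \<and>
    T = (\<Sum>m\<in>{1..N}. (x m - x (Suc m)) *\<^sub>R p m)"
  using assms
proof (induction N arbitrary: x T rule: nat_induct_at_least)
  case base
  let ?p = "\<lambda>m. indicator {1} :: nat \<Rightarrow> real"
  have "?p m \<in> hypersimplex 1 1" for m
    using hypersimplex_append[OF zero_in_hypersimplex[of 0]] by simp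
  moreover have "T = (\<Sum>m\<in>{1..1}. (x m - x (Suc m)) *\<^sub>R ?p m)"
  proof
    fix i
    show "T i = (\<Sum>m\<in>{1..1}. (x m - x (Suc m)) *\<^sub>R ?p m) i"
      using base.prems(2)[of 2] base.prems(4) base.prems(5)[of i] by (cases "i = 1") (auto simp: scaleR_fun_def prefix_sum_def numeral_2_eq_2)
  qed
  ultimately show ?case by (intro exI[of _ ?p]) auto
next
  case (Suc N)
  note dec = Suc.prems(1) and supp = Suc.prems(2) and le = Suc.prems(3)
    and total = Suc.prems(4) and zero = Suc.prems(5)
  let ?s = "T (Suc N)"
  let ?u = "\<lambda>m. x m - x (Suc m)"
  have total': "sum T {1..N} + ?s = prefix_sum x N + x (Suc N)"
    using total by simp
  have "?s \<le> x 1" using le[of "{Suc N}"] by simp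
  moreover have "x (Suc N) \<le> ?s"
    using le[of "{1..N}"] total' by auto
  ultimately obtain k where k: "k \<in> {1..N}" "x (Suc k) \<le> ?s" "?s \<le> x k"
    using \<open>N \<ge> 1\<close> by (elim decreasing_bracket[of 1 N x ?s, rotated])
  define c where "c = x k + x (Suc k) - ?s"
  define y where "y = merge_at k c x"
  define T' where "T' = T(Suc N := 0)"
  obtain n where n: "N = Suc n" using \<open>N \<ge> 1\<close> by (cases N) auto
  have c: "x (Suc k) \<le> c" "c \<le> x k" using k by (auto simp: c_def)
  have pre: "prefix_sum y m = min (prefix_sum x m) (prefix_sum x (Suc m) - ?s)" if "m \<le> N" for m
    unfolding y_def c_def by (rule prefix_sum_merge_at_min[of n]) (use dec k n that in auto)
  have "\<exists>p. (\<forall>m\<in>{1..N}. p m \<in> hypersimplex m N) \<and> T' = (\<Sum>m\<in>{1..N}. (y m - y (Suc m)) *\<^sub>R p m)"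
  proof (rule Suc.IH)
    show "y (Suc i) \<le> y i" if "i \<ge> 1" for i
      unfolding y_def by (rule merge_at_decreasing[of "i + k"]) (use dec c k that in auto)
    show "y i = 0" if "i > N" for i
      using that k supp by (auto simp: y_def merge_at_def)
    show "sum T' I \<le> prefix_sum y (card I)" if I: "I \<subseteq> {1..N}" for I
    proof -
      have fin: "finite I" "Suc N \<notin> I" using I finite_subset by auto
      have "sum T' I = sum T I" unfolding T'_def using I by (intro sum.cong) auto
      moreover have "sum T I \<le> prefix_sum x (card I)"
        using I by (intro le) auto
      moreover have "sum T (insert (Suc N) I) \<le> prefix_sum x (card (insert (Suc N) I))"
        using I by (intro le) auto
      moreover have "card I \<le> N" using card_mono[OF _ I] by simp
      ultimately show ?thesis using fin by (simp add: pre)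
    qed
    show "sum T' {1..N} = prefix_sum y N"
    proof -
      have "sum T' {1..N} = sum T {1..N}" unfolding T'_def by (intro sum.cong) auto
      moreover have "prefix_sum y N = prefix_sum x (Suc N) - ?s"
        unfolding y_def c_def using k by (subst prefix_sum_merge_at) auto
      ultimately show ?thesis using total' by simp
    qed
    show "T' i = 0" if "i \<notin> {1..N}" for i
      using that zero by (auto simp: T'_def)
  qed
  then obtain p where p: "\<And>m. m \<in> {1..N} \<Longrightarrow> p m \<in> hypersimplex m N"
    and T': "T' = (\<Sum>m\<in>{1..N}. (y m - y (Suc m)) *\<^sub>R p m)" by blast
  \<comment> \<open>Index 0 is added with the zero vector, the point of
    \<open>hypersimplex 0 N\<close>, so that the neighbour k - 1 exists also for k = 1.\<close>
  define q where "q = p(0 := 0)"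
  have q: "q m \<in> hypersimplex m N" if "m \<le> N" for m
    using p[of m] that zero_in_hypersimplex[of N] by (cases "m = 0") (auto simp: q_def)
  let ?e = "indicator {Suc N} :: nat \<Rightarrow> real"
  have "convex (hypersimplex k (Suc N))" by (simp add: hypersimplex_def)
  moreover have "q k \<in> hypersimplex k (Suc N)" using q[of k] k hypersimplex_mono by auto
  moreover have "?e + q (k - 1) \<in> hypersimplex k (Suc N)"
    using hypersimplex_append[OF q[of "k - 1"]] k by auto
  ultimately obtain w where w: "w \<in> hypersimplex k (Suc N)"
    "(c - x (Suc k)) *\<^sub>R q k + (x k - c) *\<^sub>R (?e + q (k - 1)) = (c - x (Suc k) + (x k - c)) *\<^sub>R w"
    by (rule convex_cone_combination[where a = "c - x (Suc k)" and b = "x k - c"]) (use c in auto)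
  \<comment> \<open>Below k the coordinate 0 is appended; above k the summand comes from index m - 1
    with the coordinate 1 appended. At k both kinds occur, and \<open>w\<close> mixes them.\<close>
  define r where "r = (\<lambda>m. if m < k then q m else if m = k then w else ?e + q (m - 1))"
  have "r m \<in> hypersimplex m (Suc N)" if "m \<in> {1..Suc N}" for m
    using that w(1) k q[of m] q[of "m - 1"] hypersimplex_mono[of m N] hypersimplex_append[of "q (m - 1)" "m - 1" N]
    by (auto simp: r_def)
  moreover have "T = (\<Sum>m\<in>{1..Suc N}. ?u m *\<^sub>R r m)"
  proof
    fix j
    have wj: "?u k * w j = (c - x (Suc k)) * q k j + (x k - c) * (?e j + q (k - 1) j)"
      using fun_cong[OF w(2), of j] by (simp add: scaleR_fun_def)
    have "(\<Sum>m\<in>{1..N}. (y m - y (Suc m)) * p m j) = (\<Sum>m\<in>{0..N}. (y m - y (Suc m)) * q m j)"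
      by (rule sum.mono_neutral_cong_left) (auto simp: q_def)
    \<comment> \<open>Merging changes two coefficients: the one at k - 1 exceeds
      \<open>?u (k - 1)\<close> by \<open>x k - c\<close>, and the one at k exceeds
      \<open>?u (Suc k)\<close> by \<open>c - x (Suc k)\<close>. The two excesses add up to
      \<open>?u k\<close>, the weight of \<open>w\<close>.\<close>
    also have "\<dots> = (\<Sum>m\<in>{0..N}. (if m < k then ?u m else ?u (Suc m)) * q m j +
       (if m = k - 1 then (x k - c) * q m j else 0) + (if m = k then (c - x (Suc k)) * q m j else 0))"
      using k(1) by (intro sum.cong refl) (auto simp: y_def merge_at_def algebra_simps)
    also have "\<dots> = (\<Sum>m\<in>{0..N}. (if m < k then ?u m else ?u (Suc m)) * q m j) +
       (x k - c) * q (k - 1) j + (c - x (Suc k)) * q k j"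
      using k(1) by (auto simp: sum.distrib)
    also have "\<dots> = (\<Sum>m\<in>{0..N}. (if m < k then ?u m else ?u (Suc m)) * q m j) + ?u k * w j - (x k - c) * ?e j"
      unfolding wj by (simp add: algebra_simps)
    also have "{0..N} = {0..<k} \<union> {k..N}" using k(1) by auto
    also have "(\<Sum>m\<in>{0..<k} \<union> {k..N}. (if m < k then ?u m else ?u (Suc m)) * q m j) =
       (\<Sum>m\<in>{0..<k}. ?u m * q m j) + (\<Sum>m\<in>{k..N}. ?u (Suc m) * q m j)"
      by (subst sum.union_disjoint) auto
    also have "(\<Sum>m\<in>{0..<k}. ?u m * q m j) = (\<Sum>m\<in>{1..<k}. ?u m * q m j)"
      by (rule sum.mono_neutral_right) (auto simp: q_def)
    also have "(\<Sum>m\<in>{k..N}. ?u (Suc m) * q m j) = (\<Sum>m\<in>{Suc k..Suc N}. ?u m * q (m - 1) j)"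
      by (subst sum.shift_bounds_cl_Suc_ivl) simp
    finally have T'j: "T' j = (\<Sum>m\<in>{1..<k}. ?u m * q m j) + (\<Sum>m\<in>{Suc k..Suc N}. ?u m * q (m - 1) j) +
        ?u k * w j - (x k - c) * ?e j"
      by (simp add: T' scaleR_fun_def sum_fun_apply)
    have "{1..Suc N} = insert k ({1..<k} \<union> {Suc k..Suc N})" using k(1) by auto
    then have "(\<Sum>m\<in>{1..Suc N}. ?u m * r m j) = ?u k * w j +
        (\<Sum>m\<in>{1..<k} \<union> {Suc k..Suc N}. ?u m * r m j)"
      by (simp add: r_def)
    also have "(\<Sum>m\<in>{1..<k} \<union> {Suc k..Suc N}. ?u m * r m j) =
        (\<Sum>m\<in>{1..<k}. ?u m * r m j) + (\<Sum>m\<in>{Suc k..Suc N}. ?u m * r m j)"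
      by (rule sum.union_disjoint) auto
    also have "(\<Sum>m\<in>{1..<k}. ?u m * r m j) = (\<Sum>m\<in>{1..<k}. ?u m * q m j)"
      by (rule sum.cong) (auto simp: r_def)
    also have "(\<Sum>m\<in>{Suc k..Suc N}. ?u m * r m j) =
        (\<Sum>m\<in>{Suc k..Suc N}. ?u m * ?e j + ?u m * q (m - 1) j)"
      by (rule sum.cong) (auto simp: r_def algebra_simps)
    also have "\<dots> = (\<Sum>m\<in>{Suc k..Suc N}. ?u m) * ?e j + (\<Sum>m\<in>{Suc k..Suc N}. ?u m * q (m - 1) j)"
      by (simp only: sum.distrib sum_distrib_right)
    \<comment> \<open>The telescoping ends at \<open>x (Suc (Suc N))\<close>, which is 0. Together
      with \<open>x k - c\<close> this gives the last coordinate the value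
      \<open>T (Suc N)\<close>.\<close>
    also have "(\<Sum>m\<in>{Suc k..Suc N}. ?u m) = x (Suc k)"
      using sum_Suc_diff[of "Suc k" "Suc N" "\<lambda>m. - x m"] k(1) supp[of "Suc (Suc N)"] by simp
    finally have "(\<Sum>m\<in>{1..Suc N}. ?u m * r m j) = T' j + (x k - c + x (Suc k)) * ?e j"
      unfolding T'j by (simp add: algebra_simps)
    also have "\<dots> = T j"
      by (cases "j = Suc N") (auto simp: T'_def c_def)
    finally show "T j = (\<Sum>m\<in>{1..Suc N}. ?u m *\<^sub>R r m) j"
      by (simp add: scaleR_fun_def sum_fun_apply)
  qed
  ultimately show ?case by blast
qed

text \<open>\<open>min m k\<close> is the bound on a sum of m coordinates over the k-th
  hypersimplex, so the bounds of the permutohedron are the weighted sums of the bounds of the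
  summands.\<close>

lemma prefix_sum_tail_sums:
  fixes u :: "nat \<Rightarrow> real"
  shows "prefix_sum (\<lambda>i. \<Sum>k\<in>{i..n}. u k) m = (\<Sum>k\<in>{1..n}. u k * real (min m k))"
proof -
  have "prefix_sum (\<lambda>i. \<Sum>k\<in>{i..n}. u k) m = (\<Sum>i\<in>{1..m}. \<Sum>k\<in>{k\<in>{1..n}. i \<le> k}. u k)"
    unfolding prefix_sum_def by (intro sum.cong refl) auto
  also have "\<dots> = (\<Sum>k\<in>{1..n}. \<Sum>i\<in>{i\<in>{1..m}. i \<le> k}. u k)"
    by (rule sum.swap_restrict) auto
  also have "\<dots> = (\<Sum>k\<in>{1..n}. u k * real (min m k))"
  proof (intro sum.cong refl)
    fix k
    have "{i\<in>{1..m}. i \<le> k} = {1..min m k}" by auto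
    then show "(\<Sum>i\<in>{i\<in>{1..m}. i \<le> k}. u k) = u k * real (min m k)" by simp
  qed
  finally show ?thesis .
qed

lemma projection_hypersimplex_sum:
  assumes "\<And>k. k \<in> {1..n} \<Longrightarrow> 0 \<le> u k"
  shows "(\<lambda>t. restrict t {1..n}) ` hypersimplex_sum n u =
    projected_permutohedron n (\<lambda>i. \<Sum>k\<in>{i..n}. u k)"
    (is "_ = projected_permutohedron n ?x")
proof (intro equalityI subsetI)
  fix t' assume "t' \<in> (\<lambda>t. restrict t {1..n}) ` hypersimplex_sum n u"
  then obtain p where p: "\<And>k. k \<in> {1..n} \<Longrightarrow> p k \<in> hypersimplex k (Suc n)"
    and t': "t' = restrict (\<Sum>k\<in>{1..n}. u k *\<^sub>R p k) {1..n}"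
  proof -
    assume "t' \<in> (\<lambda>t. restrict t {1..n}) ` hypersimplex_sum n u"
    then obtain q where q: "\<forall>k\<in>{1..n}. q k \<in> (*\<^sub>R) (u k) ` hypersimplex k (Suc n)"
      "t' = restrict (\<Sum>k\<in>{1..n}. q k) {1..n}"
      by (auto simp: hypersimplex_sum_def set_sum_alt)
    then have "\<forall>k\<in>{1..n}. \<exists>p. p \<in> hypersimplex k (Suc n) \<and> q k = u k *\<^sub>R p" by blast
    then obtain p where "\<forall>k\<in>{1..n}. p k \<in> hypersimplex k (Suc n) \<and> q k = u k *\<^sub>R p k"
      by metis
    with q(2) show ?thesis by (intro that[of p]) auto
  qed
  have "sum t' I \<le> prefix_sum ?x (card I)"
    "prefix_sum ?x (Suc n) - prefix_sum ?x (Suc n - card I) \<le> sum t' I"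
    if I: "I \<subseteq> {1..n}" for I
  proof -
    have fin: "finite I" using I finite_subset by blast
    have "sum t' I = (\<Sum>i\<in>I. \<Sum>k\<in>{1..n}. u k * p k i)"
      using I by (intro sum.cong) (auto simp: t' sum_fun_apply scaleR_fun_def)
    also have "\<dots> = (\<Sum>k\<in>{1..n}. u k * sum (p k) I)"
      by (subst sum.swap) (simp add: sum_distrib_left)
    finally have eq: "sum t' I = (\<Sum>k\<in>{1..n}. u k * sum (p k) I)" .
    have le: "sum (p k) J \<le> min (card J) k" if "J \<subseteq> {1..Suc n}" "k \<in> {1..n}" for J k
    proof -
      have "sum (p k) J \<le> of_nat (card J) * 1"
        by (rule sum_bounded_above) (use p[OF that(2)] in \<open>auto dest: hypersimplex_coordinates\<close>)
      moreover have "sum (p k) J \<le> sum (p k) {1..Suc n}"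
        using p[OF that(2)] that(1) by (intro sum_mono2) (auto dest: hypersimplex_coordinates)
      ultimately show ?thesis
        using p[OF that(2)] by (auto dest: hypersimplex_coordinates(4))
    qed
    show "sum t' I \<le> prefix_sum ?x (card I)"
      unfolding eq prefix_sum_tail_sums using I
      by (intro sum_mono mult_left_mono le assms) auto
    \<comment> \<open>Lower bounds are upper bounds for the complement in \<open>{1..Suc n}\<close>,
      since the coordinates of \<open>p k\<close> sum to k.\<close>
    have "real (min (Suc n) k) - real (min (Suc n - card I) k) \<le> sum (p k) I" if k: "k \<in> {1..n}" for k
    proof -
      have "card ({1..Suc n} - I) = Suc n - card I"
        using I by (subst card_Diff_subset) (auto simp: fin)
      then have "sum (p k) ({1..Suc n} - I) \<le> real (min (Suc n - card I) k)"
        using le[of "{1..Suc n} - I" k] k by auto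
      moreover have "sum (p k) ({1..Suc n} - I) = real k - sum (p k) I"
        using I hypersimplex_coordinates(4)[OF p[OF k]] by (subst sum_diff) auto
      moreover have "min (Suc n) k = k" using k by auto
      ultimately show ?thesis by linarith
    qed
    then show "prefix_sum ?x (Suc n) - prefix_sum ?x (Suc n - card I) \<le> sum t' I"
      unfolding eq prefix_sum_tail_sums sum_subtractf[symmetric] right_diff_distrib[symmetric]
      by (intro sum_mono mult_left_mono assms)
  qed
  then show "t' \<in> projected_permutohedron n ?x"
    by (auto simp: projected_permutohedron_def t')
next
  fix t assume t: "t \<in> projected_permutohedron n ?x"
  then have le: "sum t I \<le> prefix_sum ?x (card I)"
    "prefix_sum ?x (Suc n) - prefix_sum ?x (Suc n - card I) \<le> sum t I" if "I \<subseteq> {1..n}" for I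
    using that by (auto simp: projected_permutohedron_def)
  \<comment> \<open>The coordinate lost in the projection is recovered from the fixed total.\<close>
  define T where "T = (\<lambda>i. if i \<in> {1..n} then t i
     else if i = Suc n then prefix_sum ?x (Suc n) - sum t {1..n} else 0)"
  have T: "sum T I = sum t I" if "I \<subseteq> {1..n}" for I
    using that by (intro sum.cong) (auto simp: T_def)
  have "\<exists>p. (\<forall>m\<in>{1..Suc n}. p m \<in> hypersimplex m (Suc n)) \<and>
    T = (\<Sum>m\<in>{1..Suc n}. (?x m - ?x (Suc m)) *\<^sub>R p m)"
  proof (rule permutohedron_decomposition)
    show "?x (Suc i) \<le> ?x i" if "i \<ge> 1" for i
      using assms that by (intro sum_mono2) auto
    show "sum T {1..Suc n} = prefix_sum ?x (Suc n)"
      using T[of "{1..n}"] by (simp add: T_def)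
    show "sum T I \<le> prefix_sum ?x (card I)" if I: "I \<subseteq> {1..Suc n}" for I
    proof (cases "Suc n \<in> I")
      case True
      \<comment> \<open>The upper bound for a set containing \<open>Suc n\<close> is the lower bound
        for its complement J.\<close>
      define J where "J = {1..n} - I"
      have "I = insert (Suc n) ({1..n} - J)" and J: "J \<subseteq> {1..n}"
        using I True by (auto simp: J_def le_Suc_eq)
      moreover have "card ({1..n} - J) = n - card J" "sum T ({1..n} - J) = sum t {1..n} - sum t J"
        using J finite_subset[OF J] T[of "{1..n} - J"] by (auto simp: card_Diff_subset sum_diff)
      moreover have "card J \<le> n" using card_mono[OF _ J] by simp
      ultimately have "sum T I = prefix_sum ?x (Suc n) - sum t J" "card I = Suc n - card J"
        by (auto simp: T_def)
      with le(2)[OF J] show ?thesis by simp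
    next
      case False
      then have "I \<subseteq> {1..n}" using I by (auto simp: le_Suc_eq)
      with T le(1) show ?thesis by simp
    qed
  qed (auto simp: T_def)
  then obtain p where p: "\<forall>m\<in>{1..Suc n}. p m \<in> hypersimplex m (Suc n)"
    "T = (\<Sum>m\<in>{1..Suc n}. (?x m - ?x (Suc m)) *\<^sub>R p m)" by blast
  have "?x m - ?x (Suc m) = u m" if "m \<in> {1..n}" for m
    using that by (simp add: sum.atLeast_Suc_atMost[of m n])
  \<comment> \<open>The summand with m = \<open>Suc n\<close> vanishes because the tail sums beyond
    n are empty.\<close>
  with p(2) have "T = (\<Sum>m\<in>{1..n}. u m *\<^sub>R p m)" by simp
  with p(1) have "T \<in> hypersimplex_sum n u"
    unfolding hypersimplex_sum_def
    by (subst set_sum_alt) (auto intro!: exI[of _ "\<lambda>m. u m *\<^sub>R p m"])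
  moreover have "t = restrict T {1..n}"
    using t by (auto simp: projected_permutohedron_def T_def fun_eq_iff PiE_def extensional_def)
  ultimately show "t \<in> (\<lambda>t. restrict t {1..n}) ` hypersimplex_sum n u" by blast
qed

section \<open>Increasing binary trees\<close>

definition search_trees :: "nat \<Rightarrow> nat \<Rightarrow> nat tree set"
  where "search_trees a b = {T. set_tree T = {a..<b} \<and> bst T}"

lemma search_trees_empty: "b \<le> a \<Longrightarrow> search_trees a b = {Leaf}"
  by (auto simp: search_trees_def eq_set_tree_empty)

lemma search_tree_NodeD:
  assumes "Node L k R \<in> search_trees a b"
  shows "k \<in> {a..<b}" "L \<in> search_trees a k" "R \<in> search_trees (Suc k) b"
proof -
  from assms have set: "insert k (set_tree L \<union> set_tree R) = {a..<b}"
    and lt: "\<forall>x\<in>set_tree L. x < k" "\<forall>x\<in>set_tree R. k < x" and bst: "bst L" "bst R"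
    by (auto simp: search_trees_def)
  show k: "k \<in> {a..<b}" using set by blast
  have mem: "x \<in> set_tree L \<or> x = k \<or> x \<in> set_tree R \<longleftrightarrow> a \<le> x \<and> x < b" for x
    using set by (metis Un_iff atLeastLessThan_iff insert_iff)
  have "x \<in> set_tree L \<longleftrightarrow> x \<in> {a..<k}" for x
  proof
    assume "x \<in> set_tree L"
    then show "x \<in> {a..<k}" using mem[of x] lt k by (simp add: Suc_le_eq)
  next
    assume "x \<in> {a..<k}"
    then have "a \<le> x \<and> x < b" "x \<noteq> k" "\<not> k < x" using k by auto
    then show "x \<in> set_tree L" using mem[of x] lt by blast
  qed
  then have "set_tree L = {a..<k}" by (rule set_eqI)
  then show "L \<in> search_trees a k" using bst by (simp add: search_trees_def)
  have "x \<in> set_tree R \<longleftrightarrow> x \<in> {Suc k..<b}" for x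
  proof
    assume "x \<in> set_tree R"
    then show "x \<in> {Suc k..<b}" using mem[of x] lt k by (simp add: Suc_le_eq)
  next
    assume "x \<in> {Suc k..<b}"
    then have "a \<le> x \<and> x < b" "x \<noteq> k" "\<not> x < k" using k by auto
    then show "x \<in> set_tree R" using mem[of x] lt by blast
  qed
  then have "set_tree R = {Suc k..<b}" by (rule set_eqI)
  then show "R \<in> search_trees (Suc k) b" using bst by (simp add: search_trees_def)
qed

lemma search_trees_rec:
  assumes "a < b"
  shows "search_trees a b =
    (\<lambda>(k, L, R). Node L k R) ` (SIGMA k:{a..<b}. search_trees a k \<times> search_trees (Suc k) b)"
proof (intro equalityI subsetI)
  fix T assume T: "T \<in> search_trees a b"
  with assms obtain L k R where "T = Node L k R"
    by (cases T) (auto simp: search_trees_def)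
  with search_tree_NodeD[of L k R a b] T
  show "T \<in> (\<lambda>(k, L, R). Node L k R) ` (SIGMA k:{a..<b}. search_trees a k \<times> search_trees (Suc k) b)"
    by (auto intro!: image_eqI[of _ _ "(k, L, R)"])
qed (auto simp: search_trees_def)

lemma finite_search_trees: "finite (search_trees a b)"
proof (induction "b - a" arbitrary: a b rule: less_induct)
  case less
  show ?case
  proof (cases "a < b")
    case True
    have "finite (search_trees a k)" "finite (search_trees (Suc k) b)" if "k \<in> {a..<b}" for k
      using that by (auto intro: less.hyps)
    then show ?thesis
      unfolding search_trees_rec[OF True] by (intro finite_imageI finite_SigmaI finite_cartesian_product) auto
  qed (simp add: search_trees_empty)
qed

text \<open>For a given word a tree has at most one compatible increasing labeling, because every
  letter is routed by comparison with the roots it meets. For letters in range this is the weight of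
  that labeling, or 0 if none exists.\<close>

fun tree_word_weight :: "nat \<Rightarrow> nat \<Rightarrow> nat tree \<Rightarrow> nat list \<Rightarrow> real"
  where
    "tree_word_weight a b Leaf w = (if w = [] then 1 else 0)"
  | "tree_word_weight a b (Node L k R) [] = 0"
  | "tree_word_weight a b (Node L k R) (i # w) =
      (if k \<in> set w then 0
       else tent a b i k * tree_word_weight a k L (filter (\<lambda>j. j < k) w) *
         tree_word_weight (Suc k) b R (filter (\<lambda>j. k < j) w))"

lemma sum_tree_word_weight:
  "(\<Sum>T\<in>search_trees a b. tree_word_weight a b T w) = word_weight a b w"
proof (induction a b w rule: word_weight.induct)
  case (1 a b)
  have "tree_word_weight a b T [] = 0" if "a < b" "T \<in> search_trees a b" for T
    using that by (cases T) (auto simp: search_trees_def)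
  then show ?case by (cases "a < b") (auto simp: search_trees_empty)
next
  case (2 a b i w)
  show ?case
  proof (cases "a < b")
    case True
    let ?S = "SIGMA k:{a..<b}. search_trees a k \<times> search_trees (Suc k) b"
    have inj: "inj_on (\<lambda>(k, L, R). Node L k R) ?S" by (auto simp: inj_on_def)
    have "(\<Sum>T\<in>search_trees a b. tree_word_weight a b T (i # w)) =
       (\<Sum>k\<in>{a..<b}. \<Sum>(L, R)\<in>search_trees a k \<times> search_trees (Suc k) b. tree_word_weight a b (Node L k R) (i # w))"
      unfolding search_trees_rec[OF True] sum.reindex[OF inj]
      by (subst sum.Sigma) (auto simp: finite_search_trees intro!: sum.cong)
    also have "\<dots> = (\<Sum>k\<in>{a..<b}. if k \<in> set w then 0 else tent a b i k *
       word_weight a k (filter (\<lambda>j. j < k) w) * word_weight (Suc k) b (filter (\<lambda>j. k < j) w))"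
    proof (rule sum.cong[OF refl])
      fix k assume k: "k \<in> {a..<b}"
      show "(\<Sum>(L, R)\<in>search_trees a k \<times> search_trees (Suc k) b. tree_word_weight a b (Node L k R) (i # w)) =
         (if k \<in> set w then 0 else tent a b i k *
       word_weight a k (filter (\<lambda>j. j < k) w) * word_weight (Suc k) b (filter (\<lambda>j. k < j) w))"
      proof (cases "k \<in> set w")
        case False
        with k have k': "k \<in> {a..<b} - set w" by simp
        show ?thesis
          using False
          unfolding 2[OF k', symmetric] mult.assoc sum_product sum.cartesian_product
          by (simp add: sum_distrib_left case_prod_unfold mult.assoc)
      qed simp
    qed
    also have "\<dots> = word_weight a b (i # w)"
      unfolding word_weight.simps by (rule sum.mono_neutral_cong_right) auto
    finally show ?thesis .
  qed (simp add: search_trees_empty)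
qed

section \<open>Labelings of subtrees\<close>

lemma desc_Node:
  assumes "bst (Node L k R)"
  shows "desc k (Node L k R) = set_tree (Node L k R)"
    and "j \<in> set_tree L \<Longrightarrow> desc j (Node L k R) = desc j L"
    and "j \<in> set_tree R \<Longrightarrow> desc j (Node L k R) = desc j R"
proof -
  have "k \<notin> set_tree L" "k \<notin> set_tree R" "set_tree L \<inter> set_tree R = {}"
    using assms by force+
  then show "desc k (Node L k R) = set_tree (Node L k R)"
    "j \<in> set_tree L \<Longrightarrow> desc j (Node L k R) = desc j L"
    "j \<in> set_tree R \<Longrightarrow> desc j (Node L k R) = desc j R"
    by (auto simp: desc_def dest: in_set_tree_if)
qed

lemma set_tree_subtrees: "s \<in> subtrees t \<Longrightarrow> set_tree s \<subseteq> set_tree t"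
  by (induction t) auto

lemma desc_subset: "desc j T \<subseteq> set_tree T"
  using set_tree_subtrees by (fastforce simp: desc_def)

lemma desc_self: "j \<in> set_tree T \<Longrightarrow> j \<in> desc j T"
  by (auto simp: desc_def dest: set_treeE)

lemma desc_bounds:
  assumes "set_tree T = {a..<b}" "j \<in> set_tree T"
  shows "a \<le> desc_min j T" "desc_max j T < b"
proof -
  have "finite (desc j T)" "desc j T \<noteq> {}"
    using desc_subset finite_set_tree finite_subset desc_self[OF assms(2)] by blast+
  then have "desc_min j T \<in> desc j T" "desc_max j T \<in> desc j T"
    by (auto simp: desc_min_def desc_max_def)
  then show "a \<le> desc_min j T" "desc_max j T < b"
    using desc_subset[of j T] assms(1) by auto
qed

lemma filter_sorted_list_of_set:
  assumes "finite S"
  shows "filter P (sorted_list_of_set S) = sorted_list_of_set {x \<in> S. P x}"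
  using assms by (intro sorted_distinct_set_unique) (auto intro: sorted_filter[of "\<lambda>x. x", simplified])

text \<open>Subtrees carry arbitrary label sets, hence a set \<open>S\<close> instead of an initial
  segment. Extensionality makes a labeling recoverable from the root label and its restrictions to
  the two subtrees.\<close>

definition labelings :: "(nat \<Rightarrow> nat) \<Rightarrow> nat tree \<Rightarrow> nat set \<Rightarrow> (nat \<Rightarrow> nat) set"
  where "labelings i T S = {v \<in> extensional (set_tree T). bij_betw v (set_tree T) S \<and>
    (\<forall>j\<in>set_tree T. \<forall>d\<in>desc j T. v j \<le> v d) \<and>
    (\<forall>j\<in>set_tree T. i (v j) \<in> {desc_min j T..desc_max j T})}"

lemma labelings_Leaf: "labelings i Leaf S = (if S = {} then {\<lambda>_. undefined} else {})"
  by (auto simp: labelings_def bij_betw_def)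

lemma labelings_root:
  assumes "v \<in> labelings i (Node L k R) S" "bst (Node L k R)" "finite S"
  shows "v k = Min S"
proof -
  from assms(1) have bij: "v ` set_tree (Node L k R) = S"
    and "\<forall>j\<in>set_tree (Node L k R). \<forall>d\<in>desc j (Node L k R). v j \<le> v d"
    unfolding labelings_def bij_betw_def by blast+
  from this(2) have le: "\<forall>d\<in>set_tree (Node L k R). v k \<le> v d"
    using desc_Node(1)[OF assms(2)] by (auto dest: bspec[of _ _ k])
  show ?thesis
    using bij le assms(3) by (intro Min_eqI[symmetric]) auto
qed

text \<open>Descendant intervals of nodes in L lie in \<open>{a..<k}\<close>, those of nodes in R in
  \<open>{Suc k..<b}\<close>. So the letter of a label decides its side, and no label other than the
  root's can have letter k.\<close>

lemma labelings_left_right: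
  assumes v: "v \<in> labelings i (Node L k R) S" and T: "Node L k R \<in> search_trees a b" and "finite S"
  defines "S1 \<equiv> {s \<in> S - {Min S}. i s < k}" and "S2 \<equiv> {s \<in> S - {Min S}. k < i s}"
  shows "k \<notin> i ` (S - {Min S})"
    and "restrict v (set_tree L) \<in> labelings i L S1"
    and "restrict v (set_tree R) \<in> labelings i R S2"
proof -
  note LR = search_tree_NodeD[OF T]
  have bst: "bst (Node L k R)" using T by (simp add: search_trees_def)
  note desc = desc_Node[OF bst]
  have set: "set_tree L = {a..<k}" "set_tree R = {Suc k..<b}" using LR by (auto simp: search_trees_def)
  have vk: "v k = Min S" using labelings_root[OF v bst \<open>finite S\<close>] .
  from v have bij: "bij_betw v (insert k (set_tree L \<union> set_tree R)) S"
    and inc: "\<And>j d. j \<in> set_tree (Node L k R) \<Longrightarrow> d \<in> desc j (Node L k R) \<Longrightarrow> v j \<le> v d"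
    and comp: "\<And>j. j \<in> set_tree (Node L k R) \<Longrightarrow>
       i (v j) \<in> {desc_min j (Node L k R)..desc_max j (Node L k R)}"
    by (auto simp: labelings_def)
  have lt: "i (v j) < k" if "j \<in> set_tree L" for j
    using comp[of j] desc_bounds[OF set(1) that] desc(2)[OF that] that
    by (auto simp: desc_min_def desc_max_def)
  have gt: "k < i (v j)" if "j \<in> set_tree R" for j
    using comp[of j] desc_bounds[OF set(2) that] desc(3)[OF that] that
    by (auto simp: desc_min_def desc_max_def)
  have "k \<notin> set_tree L \<union> set_tree R" using set by auto
  then have "insert (Min S) (v ` (set_tree L \<union> set_tree R)) = S"
    "Min S \<notin> v ` (set_tree L \<union> set_tree R)"
    using bij vk by (auto simp: bij_betw_def)
  then have img: "v ` (set_tree L \<union> set_tree R) = S - {Min S}" by blast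
  have inj: "inj_on v (set_tree L)" "inj_on v (set_tree R)"
    using bij by (auto simp: bij_betw_def intro: inj_on_subset)
  show "k \<notin> i ` (S - {Min S})"
    unfolding img[symmetric] using lt gt by force
  have "v ` set_tree L = S1"
    using img lt gt unfolding S1_def by (force simp flip: img)
  moreover have "v ` set_tree R = S2"
    using img lt gt unfolding S2_def by (force simp flip: img)
  ultimately have bijs: "bij_betw v (set_tree L) S1" "bij_betw v (set_tree R) S2"
    using inj by (auto simp: bij_betw_def)
  have "v j \<le> v d" "d \<in> set_tree L" "i (v j) \<in> {desc_min j L..desc_max j L}"
    if "j \<in> set_tree L" "d \<in> desc j L" for j d
    using inc[of j d] comp[of j] that desc(2)[OF that(1)] desc_subset[of j L]
    by (auto simp: desc_min_def desc_max_def)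
  then show "restrict v (set_tree L) \<in> labelings i L S1"
    using bijs(1) desc_self[of _ L] by (fastforce simp: labelings_def)
  have "v j \<le> v d" "d \<in> set_tree R" "i (v j) \<in> {desc_min j R..desc_max j R}"
    if "j \<in> set_tree R" "d \<in> desc j R" for j d
    using inc[of j d] comp[of j] that desc(3)[OF that(1)] desc_subset[of j R]
    by (auto simp: desc_min_def desc_max_def)
  then show "restrict v (set_tree R) \<in> labelings i R S2"
    using bijs(2) desc_self[of _ R] by (fastforce simp: labelings_def)
qed

text \<open>The converse gluing. The root is compatible because its descendants fill
  \<open>{a..<b}\<close>, which contains all letters, and increasing because it receives
  \<open>Min S\<close>.\<close>

lemma labelings_combine:
  assumes v1: "v1 \<in> labelings i L S1" and v2: "v2 \<in> labelings i R S2"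
    and T: "Node L k R \<in> search_trees a b" and S: "finite S" "S \<noteq> {}" "i ` S \<subseteq> {a..<b}"
    and S12: "S1 \<union> S2 = S - {Min S}" "S1 \<inter> S2 = {}"
  defines "v \<equiv> \<lambda>j. if j = k then Min S else if j \<in> set_tree L then v1 j
    else if j \<in> set_tree R then v2 j else undefined"
  shows "v \<in> labelings i (Node L k R) S"
    and "restrict v (set_tree L) = v1" "restrict v (set_tree R) = v2"
proof -
  note LR = search_tree_NodeD[OF T]
  have bst: "bst (Node L k R)" using T by (simp add: search_trees_def)
  note desc = desc_Node[OF bst]
  have set: "set_tree L = {a..<k}" "set_tree R = {Suc k..<b}" "set_tree (Node L k R) = {a..<b}"
    using LR T by (auto simp: search_trees_def)
  have vL: "v j = v1 j" if "j \<in> set_tree L" for j using that by (auto simp: v_def set)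
  have vR: "v j = v2 j" if "j \<in> set_tree R" for j using that by (auto simp: v_def set)
  have vk: "v k = Min S" by (simp add: v_def)
  show "restrict v (set_tree L) = v1" "restrict v (set_tree R) = v2"
    using v1 v2 vL vR by (auto simp: labelings_def extensional_def fun_eq_iff)
  have bij1: "bij_betw v (set_tree L) S1" and bij2: "bij_betw v (set_tree R) S2"
    using v1 v2 bij_betw_cong[of "set_tree L" v v1 S1] bij_betw_cong[of "set_tree R" v v2 S2] vL vR
    by (auto simp: labelings_def)
  have "bij_betw v (set_tree L \<union> set_tree R) (S - {Min S})"
    using bij_betw_combine[OF bij1 bij2 S12(2)] S12(1) by simp
  moreover have "bij_betw v {k} {Min S}" by (simp add: vk)
  ultimately have "bij_betw v ((set_tree L \<union> set_tree R) \<union> {k}) ((S - {Min S}) \<union> {Min S})"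
    by (intro bij_betw_combine) auto
  moreover have "(S - {Min S}) \<union> {Min S} = S" using Min_in[OF S(1,2)] by blast
  moreover have "(set_tree L \<union> set_tree R) \<union> {k} = set_tree (Node L k R)" by auto
  ultimately have bij: "bij_betw v (set_tree (Node L k R)) S" by simp
  have inc: "v j \<le> v d" if j: "j \<in> set_tree (Node L k R)" and d: "d \<in> desc j (Node L k R)" for j d
  proof -
    consider "j = k" | "j \<in> set_tree L" | "j \<in> set_tree R" using j by auto
    then show ?thesis
    proof cases
      case 1
      have "d \<in> set_tree (Node L k R)" using d desc_subset by blast
      then have "v d \<in> S" using bij by (auto simp: bij_betw_def)
      then show ?thesis using 1 vk S(1) by simp
    next
      case 2
      then have "d \<in> desc j L" using d desc(2) by simp
      moreover from this have "d \<in> set_tree L" using desc_subset by blast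
      ultimately show ?thesis using 2 v1 vL by (auto simp: labelings_def)
    next
      case 3
      then have "d \<in> desc j R" using d desc(3) by simp
      moreover from this have "d \<in> set_tree R" using desc_subset by blast
      ultimately show ?thesis using 3 v2 vR by (auto simp: labelings_def)
    qed
  qed
  have comp: "i (v j) \<in> {desc_min j (Node L k R)..desc_max j (Node L k R)}"
    if j: "j \<in> set_tree (Node L k R)" for j
  proof -
    consider "j = k" | "j \<in> set_tree L" | "j \<in> set_tree R" using j by auto
    then show ?thesis
    proof cases
      case 1
      have "desc k (Node L k R) = {a..<b}" using desc(1) set by simp
      moreover have "i (Min S) \<in> {a..<b}" using S Min_in[OF S(1,2)] by blast
      ultimately show ?thesis using 1 vk by (auto simp: desc_min_def desc_max_def)
    next
      case 2
      then show ?thesis using v1 vL desc(2) by (auto simp: labelings_def desc_min_def desc_max_def)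
    next
      case 3
      then show ?thesis using v2 vR desc(3) by (auto simp: labelings_def desc_min_def desc_max_def)
    qed
  qed
  have "v \<in> extensional (set_tree (Node L k R))" by (auto simp: v_def extensional_def)
  with bij inc comp show "v \<in> labelings i (Node L k R) S"
    unfolding labelings_def by blast
qed

text \<open>Restriction to the two subtrees is a bijection onto pairs of labelings with label sets
  fixed by the letters, and the weight is multiplicative. Removing the minimum and filtering by
  letters keeps the labels sorted, which matches the recursion on words.\<close>

lemma sum_labelings:
  assumes "T \<in> search_trees a b" "finite S" "i ` S \<subseteq> {a..<b}"
  shows "(\<Sum>v\<in>labelings i T S. \<Prod>j\<in>set_tree T. wt T (i (v j)) j) =
    tree_word_weight a b T (map i (sorted_list_of_set S))"
  using assms
proof (induction T arbitrary: a b S)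
  case Leaf
  then have "S = {}" by (auto simp: search_trees_def)
  then show ?case by (simp add: labelings_Leaf)
next
  case (Node L k R)
  let ?T = "Node L k R"
  note T = Node.prems(1) and fin = Node.prems(2) and iS = Node.prems(3)
  note LR = search_tree_NodeD[OF T]
  have bst: "bst ?T" using T by (simp add: search_trees_def)
  note desc = desc_Node[OF bst]
  have set: "set_tree L = {a..<k}" "set_tree R = {Suc k..<b}" "set_tree ?T = {a..<b}"
    using LR T by (auto simp: search_trees_def)
  show ?case
  proof (cases "S = {}")
    case True
    then have "labelings i ?T S = {}" by (auto simp: labelings_def bij_betw_def)
    then show ?thesis using True by simp
  next
    case False
    define s0 where "s0 = Min S"
    define S1 where "S1 = {s \<in> S - {s0}. i s < k}"
    define S2 where "S2 = {s \<in> S - {s0}. k < i s}"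
    have list: "sorted_list_of_set S = s0 # sorted_list_of_set (S - {s0})"
      unfolding s0_def using fin False by (rule sorted_list_of_set_nonempty)
    have filters: "filter (\<lambda>j. j < k) (map i (sorted_list_of_set (S - {s0}))) = map i (sorted_list_of_set S1)"
      "filter (\<lambda>j. k < j) (map i (sorted_list_of_set (S - {s0}))) = map i (sorted_list_of_set S2)"
      using fin by (auto simp: filter_map o_def filter_sorted_list_of_set S1_def S2_def)
    show ?thesis
    proof (cases "k \<in> i ` (S - {s0})")
      case True
      then have "labelings i ?T S = {}"
        using labelings_left_right(1)[OF _ T fin] unfolding s0_def by blast
      then show ?thesis using True fin unfolding list by simp
    next
      case k: False
      have S12: "S1 \<union> S2 = S - {Min S}" "S1 \<inter> S2 = {}"
        using k by (auto simp: S1_def S2_def s0_def)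
      let ?pL = "\<lambda>v. \<Prod>j\<in>set_tree L. wt L (i (v j)) j" and ?pR = "\<lambda>v. \<Prod>j\<in>set_tree R. wt R (i (v j)) j"
      have "(\<Sum>v\<in>labelings i ?T S. \<Prod>j\<in>set_tree ?T. wt ?T (i (v j)) j) =
        (\<Sum>(v1, v2)\<in>labelings i L S1 \<times> labelings i R S2. tent a b (i s0) k * (?pL v1 * ?pR v2))"
      proof (rule sum.reindex_bij_witness[of _ "\<lambda>(v1, v2) j. if j = k then Min S else
           if j \<in> set_tree L then v1 j else if j \<in> set_tree R then v2 j else undefined"
           "\<lambda>v. (restrict v (set_tree L), restrict v (set_tree R))"])
        fix v assume v: "v \<in> labelings i ?T S"
        have vk: "v k = s0" using labelings_root[OF v bst fin] by (simp add: s0_def)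
        have "v \<in> extensional (set_tree ?T)" using v by (simp add: labelings_def)
        then show "(case (restrict v (set_tree L), restrict v (set_tree R)) of (v1, v2) \<Rightarrow>
            \<lambda>j. if j = k then Min S else if j \<in> set_tree L then v1 j
              else if j \<in> set_tree R then v2 j else undefined) = v"
          using vk by (auto simp: fun_eq_iff extensional_def s0_def)
        show "(restrict v (set_tree L), restrict v (set_tree R)) \<in> labelings i L S1 \<times> labelings i R S2"
          using labelings_left_right(2,3)[OF v T fin] by (simp add: S1_def S2_def s0_def)
        have wtL: "wt ?T (i (v j)) j = wt L (i (restrict v (set_tree L) j)) j" if "j \<in> set_tree L" for j
          using that desc(2)[OF that] by (simp add: wt_def desc_min_def desc_max_def)
        have wtR: "wt ?T (i (v j)) j = wt R (i (restrict v (set_tree R) j)) j" if "j \<in> set_tree R" for j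
          using that desc(3)[OF that] by (simp add: wt_def desc_min_def desc_max_def)
        have "desc k ?T = {a..<b}" using desc(1) set by simp
        \<comment> \<open>The largest descendant is b - 1, so \<open>desc_max\<close> minus i plus 1
          in \<open>wt\<close> is b - i in \<open>tent\<close>.\<close>
        moreover have "Min {a..<b} = a" "Max {a..<b} = b - 1"
          using LR(1) by (auto intro!: Min_eqI Max_eqI)
        ultimately have wtk: "wt ?T (i (v k)) k = tent a b (i s0) k"
          using LR(1) by (simp add: vk wt_def desc_min_def desc_max_def tent_def of_nat_diff)
        have "set_tree ?T = insert k (set_tree L \<union> set_tree R)" by auto
        then have "(\<Prod>j\<in>set_tree ?T. wt ?T (i (v j)) j) =
          wt ?T (i (v k)) k * ((\<Prod>j\<in>set_tree L. wt ?T (i (v j)) j) * (\<Prod>j\<in>set_tree R. wt ?T (i (v j)) j))"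
          by (simp add: set prod.union_disjoint)
        then show "(case (restrict v (set_tree L), restrict v (set_tree R)) of (v1, v2) \<Rightarrow>
            tent a b (i s0) k * (?pL v1 * ?pR v2)) = (\<Prod>j\<in>set_tree ?T. wt ?T (i (v j)) j)"
          by (simp add: wtL wtR wtk)
      next
        fix vv assume vv: "vv \<in> labelings i L S1 \<times> labelings i R S2"
        then show "(case vv of (v1, v2) \<Rightarrow> \<lambda>j. if j = k then Min S else
           if j \<in> set_tree L then v1 j else if j \<in> set_tree R then v2 j else undefined) \<in> labelings i ?T S"
          "(restrict (case vv of (v1, v2) \<Rightarrow> \<lambda>j. if j = k then Min S else
           if j \<in> set_tree L then v1 j else if j \<in> set_tree R then v2 j else undefined) (set_tree L),
           restrict (case vv of (v1, v2) \<Rightarrow> \<lambda>j. if j = k then Min S else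
           if j \<in> set_tree L then v1 j else if j \<in> set_tree R then v2 j else undefined) (set_tree R)) = vv"
          using labelings_combine[OF _ _ T fin False iS S12] by (auto simp only: split: prod.splits)
      qed
      also have "\<dots> = tent a b (i s0) k * ((\<Sum>v\<in>labelings i L S1. ?pL v) * (\<Sum>v\<in>labelings i R S2. ?pR v))"
        unfolding sum_product sum.cartesian_product by (simp add: sum_distrib_left case_prod_unfold)
      also have "(\<Sum>v\<in>labelings i L S1. ?pL v) = tree_word_weight a k L (map i (sorted_list_of_set S1))"
        using LR fin iS by (intro Node.IH) (auto simp: S1_def)
      also have "(\<Sum>v\<in>labelings i R S2. ?pR v) = tree_word_weight (Suc k) b R (map i (sorted_list_of_set S2))"
        using LR fin iS by (intro Node.IH) (auto simp: S2_def)
      finally show ?thesis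
        using k fin by (simp add: list filters)
    qed
  qed
qed

lemma sum_increasing_binary_trees:
  assumes "\<forall>j\<in>{1..n}. i j \<in> {1..n}"
  shows "(\<Sum>(T, v)\<in>{(T, v) \<in> increasing_binary_trees n. compatible n i T v}. tree_weight n i T v) =
    word_weight 1 (Suc n) (map i [1..<Suc n])"
proof -
  let ?P = "\<lambda>T. {v. increasing_labeling n T v \<and> compatible n i T v}"
  have size: "size T = n" if "T \<in> search_trees 1 (Suc n)" for T
  proof -
    have "distinct (inorder T)" "set (inorder T) = {1..<Suc n}"
      using that by (auto simp: search_trees_def bst_iff_sorted_wrt_less strict_sorted_iff)
    then show ?thesis using distinct_card[of "inorder T"] by simp
  qed
  then have "plane_binary_trees n = search_trees 1 (Suc n)"
    by (auto simp: plane_binary_trees_def search_trees_def atLeastLessThanSuc_atLeastAtMost)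
  then have "{(T, v) \<in> increasing_binary_trees n. compatible n i T v} = Sigma (search_trees 1 (Suc n)) ?P"
    by (auto simp: increasing_binary_trees_def)
  moreover have "finite (?P T)" for T
    by (rule finite_subset[OF _ finite_permutations[of "{1..n}"]]) (auto simp: increasing_labeling_def)
  ultimately have "(\<Sum>(T, v)\<in>{(T, v) \<in> increasing_binary_trees n. compatible n i T v}. tree_weight n i T v) =
     (\<Sum>T\<in>search_trees 1 (Suc n). \<Sum>v\<in>?P T. tree_weight n i T v)"
    by (simp add: sum.Sigma finite_search_trees)
  also have "\<dots> = (\<Sum>T\<in>search_trees 1 (Suc n). tree_word_weight 1 (Suc n) T (map i (sorted_list_of_set {1..n})))"
  proof (rule sum.cong[OF refl])
    fix T assume T: "T \<in> search_trees 1 (Suc n)"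
    then have set: "set_tree T = {1..n}"
      by (simp add: search_trees_def atLeastLessThanSuc_atLeastAtMost)
    have sub: "d \<in> {1..n}" if "d \<in> desc j T" for d j using that desc_subset[of j T] set by auto
    have "(\<Sum>v\<in>?P T. tree_weight n i T v) = (\<Sum>v\<in>labelings i T {1..n}. \<Prod>j\<in>set_tree T. wt T (i (v j)) j)"
    \<comment> \<open>Permutations are the identity outside \<open>{1..n}\<close> and labelings are
      undefined there; the witnesses only convert between these defaults.\<close>
    proof (rule sum.reindex_bij_witness[of _ "\<lambda>v j. if j \<in> {1..n} then v j else j" "\<lambda>v. restrict v {1..n}"])
      fix v assume "v \<in> ?P T"
      then have v: "v permutes {1..n}" "\<And>j d. j \<in> {1..n} \<Longrightarrow> d \<in> desc j T \<Longrightarrow> v j \<le> v d"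
        "\<And>j. j \<in> {1..n} \<Longrightarrow> i (v j) \<in> {desc_min j T..desc_max j T}"
        by (auto simp: increasing_labeling_def compatible_def)
      show "(\<lambda>j. if j \<in> {1..n} then restrict v {1..n} j else j) = v"
        using permutes_not_in[OF v(1)] by (auto simp: fun_eq_iff)
      show "restrict v {1..n} \<in> labelings i T {1..n}"
        unfolding labelings_def set
        using v sub permutes_imp_bij[OF v(1)] by simp
      show "(\<Prod>j\<in>set_tree T. wt T (i (restrict v {1..n} j)) j) = tree_weight n i T v"
        unfolding set tree_weight_def by (rule prod.cong) auto
    next
      fix v assume "v \<in> labelings i T {1..n}"
      then have v: "v \<in> extensional {1..n}" "bij_betw v {1..n} {1..n}"
        "\<And>j d. j \<in> {1..n} \<Longrightarrow> d \<in> desc j T \<Longrightarrow> v j \<le> v d"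
        "\<And>j. j \<in> {1..n} \<Longrightarrow> i (v j) \<in> {desc_min j T..desc_max j T}"
        unfolding labelings_def set by auto
      show "restrict (\<lambda>j. if j \<in> {1..n} then v j else j) {1..n} = v"
        using v(1) by (auto simp: fun_eq_iff extensional_def)
      have "bij_betw (\<lambda>j. if j \<in> {1..n} then v j else j) {1..n} {1..n}"
        using v(2) by (subst bij_betw_cong[of _ _ v]) auto
      then have "(\<lambda>j. if j \<in> {1..n} then v j else j) permutes {1..n}"
        by (rule bij_imp_permutes) auto
      then show "(\<lambda>j. if j \<in> {1..n} then v j else j) \<in> ?P T"
        using v(3,4) sub by (auto simp: increasing_labeling_def compatible_def)
    qed
    also have "\<dots> = tree_word_weight 1 (Suc n) T (map i (sorted_list_of_set {1..n}))"
      using T assms by (intro sum_labelings) auto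
    finally show "(\<Sum>v\<in>?P T. tree_weight n i T v) = \<dots>" .
  qed
  also have "sorted_list_of_set {1..n} = [1..<Suc n]"
    by (metis atLeastLessThanSuc_atLeastAtMost sorted_list_of_set_range)
  finally show ?thesis by (simp only: sum_tree_word_weight)
qed

section \<open>Coefficients of the volume polynomial\<close>

text \<open>The volume identity is available only for nonnegative arguments. Induction on the
  variables: with the others frozen, a polynomial in one variable that vanishes on an interval is
  zero.\<close>

lemma monomial_coefficients_unique:
  fixes a :: "('a \<Rightarrow> nat) \<Rightarrow> real"
  assumes "finite I" "finite C" "C \<subseteq> I \<rightarrow>\<^sub>E UNIV"
    and "\<And>u. (\<And>i. i \<in> I \<Longrightarrow> 0 \<le> u i) \<Longrightarrow> (\<Sum>c\<in>C. a c * (\<Prod>i\<in>I. u i ^ c i)) = 0"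
    and "c \<in> C"
  shows "a c = 0"
  using assms
proof (induction I arbitrary: C a c rule: finite_induct)
  case empty
  then have "C = {c}" by auto
  with empty.prems(3)[of "\<lambda>_. 0"] show ?case by simp
next
  case (insert j I)
  define m where "m = c j"
  let ?Cm = "{d \<in> C. d j = m}"
  let ?r = "\<lambda>d. restrict d I"
  have fun_upd: "(?r d)(j := m) = d" if "d \<in> ?Cm" for d
  proof
    fix x
    have "d \<in> C" "d j = m" using that by blast+
    moreover from this(1) have "d x = undefined" if "x \<notin> insert j I"
      using insert.prems(2) that by (blast intro: PiE_arb)
    ultimately show "((?r d)(j := m)) x = d x" by (cases "x = j"; cases "x \<in> I") simp_all
  qed
  then have inj: "inj_on ?r ?Cm" by (rule inj_on_inverseI[where g = "\<lambda>d. d(j := m)"])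
  have zero: "(\<Sum>d\<in>?r ` ?Cm. a (d(j := m)) * (\<Prod>i\<in>I. u i ^ d i)) = 0"
    if u: "\<And>i. i \<in> I \<Longrightarrow> 0 \<le> u i" for u
  proof -
    \<comment> \<open>The values collected by powers of variable j; the coefficient at m is an
      expression of the same kind in the remaining variables.\<close>
    define P where "P = (\<Sum>d\<in>C. monom (a d * (\<Prod>i\<in>I. u i ^ d i)) (d j))"
    have "poly P t = 0" if "0 \<le> t" for t
    proof -
      have "(\<Prod>i\<in>insert j I. (u(j := t)) i ^ d i) = t ^ d j * (\<Prod>i\<in>I. u i ^ d i)" for d
      proof -
        have "(\<Prod>i\<in>I. (u(j := t)) i ^ d i) = (\<Prod>i\<in>I. u i ^ d i)"
          using insert.hyps(2) by (intro prod.cong refl) auto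
        then show ?thesis using insert.hyps by simp
      qed
      then have "poly P t = (\<Sum>d\<in>C. a d * (\<Prod>i\<in>insert j I. (u(j := t)) i ^ d i))"
        by (simp add: P_def poly_sum poly_monom mult_ac)
      also have "\<dots> = 0"
        using u that insert.hyps by (intro insert.prems(3)) auto
      finally show ?thesis .
    qed
    then have "{0..1} \<subseteq> {t. poly P t = 0}" by auto
    then have "infinite {t. poly P t = 0}"
      by (rule infinite_super) (rule infinite_Icc, simp)
    then have "P = 0" using poly_roots_finite by blast
    then have "0 = coeff P m" by simp
    also have "\<dots> = (\<Sum>d\<in>C. if d j = m then a d * (\<Prod>i\<in>I. u i ^ d i) else 0)"
      by (simp add: P_def coeff_sum)
    also have "\<dots> = (\<Sum>d\<in>?Cm. a d * (\<Prod>i\<in>I. u i ^ d i))"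
      using insert.prems(1) by (simp add: sum.inter_filter)
    also have "\<dots> = (\<Sum>d\<in>?Cm. a ((?r d)(j := m)) * (\<Prod>i\<in>I. u i ^ ?r d i))"
      by (intro sum.cong refl) (simp add: fun_upd)
    also have "\<dots> = (\<Sum>d\<in>?r ` ?Cm. a (d(j := m)) * (\<Prod>i\<in>I. u i ^ d i))"
      by (simp add: sum.reindex[OF inj])
    finally show ?thesis by simp
  qed
  have c: "c \<in> ?Cm" using insert.prems(4) by (simp add: m_def)
  have "a ((?r c)(j := m)) = 0"
  proof (rule insert.IH[of "?r ` ?Cm" "\<lambda>d. a (d(j := m))"])
    show "?r c \<in> ?r ` ?Cm" using c by (rule imageI)
  qed (use insert.prems(1) zero in auto)
  then show ?case using fun_upd[OF c] by simp
qed

section \<open>Exponent vectors as multisets and the coefficient family\<close>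

definition content_mset :: "nat \<Rightarrow> (nat \<Rightarrow> nat) \<Rightarrow> nat multiset"
  where "content_mset n c = (\<Sum>k\<in>{1..n}. replicate_mset (c k) k)"

lemma count_content_mset: "count (content_mset n c) k = (if k \<in> {1..n} then c k else 0)"
  by (simp add: content_mset_def count_sum)

lemma bij_betw_content_mset:
  "bij_betw (content_mset n) (exponents n) (multisets_of_size {1..<Suc n} n)"
proof (rule bij_betw_byWitness[of _ "\<lambda>m. restrict (count m) {1..n}"])
  have size: "size (content_mset n c) = (\<Sum>k\<in>{1..n}. c k)" for c
    by (simp add: content_mset_def size_multiset_sum)
  show "content_mset n ` exponents n \<subseteq> multisets_of_size {1..<Suc n} n"
  proof (intro image_subsetI)
    fix c assume "c \<in> exponents n"
    moreover have "k \<in> {1..<Suc n}" if "k \<in># content_mset n c" for k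
      using that by (auto simp: count_content_mset simp flip: count_greater_zero_iff split: if_splits)
    ultimately show "content_mset n c \<in> multisets_of_size {1..<Suc n} n"
      using size by (auto simp: multisets_of_size_def exponents_def)
  qed
  show "\<forall>c\<in>exponents n. restrict (count (content_mset n c)) {1..n} = c"
    by (auto simp: exponents_def fun_eq_iff count_content_mset PiE_def extensional_def)
  have inv: "content_mset n (restrict (count m) {1..n}) = m" if "m \<in> multisets_of_size {1..<Suc n} n" for m
    using multisets_of_size_subset[OF that]
    by (intro multiset_eqI) (auto simp: count_content_mset subset_eq not_in_iff[symmetric])
  then show "\<forall>m\<in>multisets_of_size {1..<Suc n} n. content_mset n (restrict (count m) {1..n}) = m" by blast
  show "(\<lambda>m. restrict (count m) {1..n}) ` multisets_of_size {1..<Suc n} n \<subseteq> exponents n"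
  proof (intro image_subsetI)
    fix m assume m: "m \<in> multisets_of_size {1..<Suc n} n"
    then have "(\<Sum>k\<in>{1..n}. restrict (count m) {1..n} k) = n"
      using size[of "restrict (count m) {1..n}"] inv by (simp add: multisets_of_size_size)
    then show "restrict (count m) {1..n} \<in> exponents n" by (auto simp: exponents_def)
  qed
qed

lemma finite_exponents: "finite (exponents n)"
  using bij_betw_finite[OF bij_betw_content_mset] finite_multisets_of_size by blast

text \<open>The sorted word is only a canonical choice of ordering. The restriction provides the
  extensionality required of the coefficient family.\<close>

definition eulerian_coeff :: "nat \<Rightarrow> (nat \<Rightarrow> nat) \<Rightarrow> real"
  where "eulerian_coeff n = restrict (\<lambda>c. fact n *
    word_weight 1 (Suc n) (sorted_list_of_multiset (content_mset n c))) (exponents n)"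

lemma proj_volume_hypersimplex_sum:
  assumes "\<forall>k\<in>{1..n}. 0 \<le> u k"
  shows "proj_volume n (hypersimplex_sum n u) =
    (\<Sum>c\<in>exponents n. eulerian_coeff n c * (\<Prod>k=1..n. u k ^ c k / fact (c k)))"
proof -
  let ?x = "\<lambda>i. \<Sum>k\<in>{i..n}. u k"
  have "emeasure (PiM {1..n} (\<lambda>_. lborel)) (projected_permutohedron n ?x) = ennreal (vol_poly 1 (Suc n) ?x) \<and>
     0 \<le> vol_poly 1 (Suc n) ?x"
    by (rule emeasure_projected_permutohedron) (use assms in \<open>auto intro!: sum_mono2\<close>)
  then have "proj_volume n (hypersimplex_sum n u) = vol_poly 1 (Suc n) ?x"
    using assms unfolding proj_volume_def by (subst projection_hypersimplex_sum) (auto simp: measure_def)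
  also have "\<dots> = fact n * weight_poly 1 (Suc n) u"
  proof -
    have "?x i - ?x (Suc i) = u i" if "i \<in> {1..<Suc n}" for i
      using that by (simp add: sum.atLeast_Suc_atMost[of i n])
    then have "weight_poly 1 (Suc n) (\<lambda>i. ?x i - ?x (Suc i)) = weight_poly 1 (Suc n) u"
      by (rule weight_poly_cong)
    then show ?thesis by (simp add: vol_poly_def)
  qed
  also have "\<dots> = (\<Sum>m\<in>multisets_of_size {1..<Suc n} n.
     fact n * (word_weight 1 (Suc n) (sorted_list_of_multiset m) * divided_power m u))"
    by (simp add: weight_poly_def sum_distrib_left)
  also have "\<dots> = (\<Sum>c\<in>exponents n.
     fact n * (word_weight 1 (Suc n) (sorted_list_of_multiset (content_mset n c)) * divided_power (content_mset n c) u))"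
    by (rule sum.reindex_bij_betw[OF bij_betw_content_mset, symmetric])
  also have "\<dots> = (\<Sum>c\<in>exponents n. eulerian_coeff n c * (\<Prod>k=1..n. u k ^ c k / fact (c k)))"
  proof (rule sum.cong[OF refl])
    fix c assume c: "c \<in> exponents n"
    have "set_mset (content_mset n c) \<subseteq> {1..n}"
      by (auto simp: count_content_mset simp flip: count_greater_zero_iff split: if_splits)
    then have "divided_power (content_mset n c) u = (\<Prod>k=1..n. u k ^ c k / fact (c k))"
      by (subst divided_power_superset[of "{1..n}"]) (auto simp: count_content_mset)
    with c show "fact n * (word_weight 1 (Suc n) (sorted_list_of_multiset (content_mset n c)) *
        divided_power (content_mset n c) u) =
      eulerian_coeff n c * (\<Prod>k=1..n. u k ^ c k / fact (c k))"
      by (simp add: eulerian_coeff_def)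
  qed
  finally show ?thesis .
qed

lemma mixed_eulerian_family_eq: "mixed_eulerian_family n = eulerian_coeff n"
  unfolding mixed_eulerian_family_def
proof (rule the_equality)
  show "eulerian_coeff n \<in> extensional (exponents n) \<and> (\<forall>u. (\<forall>k\<in>{1..n}. 0 \<le> u k) \<longrightarrow>
    proj_volume n (hypersimplex_sum n u) =
      (\<Sum>c\<in>exponents n. eulerian_coeff n c * (\<Prod>k=1..n. u k ^ c k / fact (c k))))"
    by (simp add: proj_volume_hypersimplex_sum) (simp add: eulerian_coeff_def)
next
  fix A
  assume A: "A \<in> extensional (exponents n) \<and> (\<forall>u. (\<forall>k\<in>{1..n}. 0 \<le> u k) \<longrightarrow>
    proj_volume n (hypersimplex_sum n u) =
      (\<Sum>c\<in>exponents n. A c * (\<Prod>k=1..n. u k ^ c k / fact (c k))))"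
  \<comment> \<open>Dividing by the factorials passes to coefficients of plain monomials, as the
    uniqueness lemma expects.\<close>
  let ?a = "\<lambda>c. (A c - eulerian_coeff n c) / (\<Prod>k=1..n. fact (c k))"
  have "?a c = 0" if "c \<in> exponents n" for c
  proof (rule monomial_coefficients_unique[where a = ?a and I = "{1..n}" and C = "exponents n"])
    fix u :: "nat \<Rightarrow> real" assume "\<And>k. k \<in> {1..n} \<Longrightarrow> 0 \<le> u k"
    then have "(\<Sum>c\<in>exponents n. A c * (\<Prod>k=1..n. u k ^ c k / fact (c k))) =
       (\<Sum>c\<in>exponents n. eulerian_coeff n c * (\<Prod>k=1..n. u k ^ c k / fact (c k)))"
      using A proj_volume_hypersimplex_sum[of n u] by auto
    then show "(\<Sum>c\<in>exponents n. ?a c * (\<Prod>k\<in>{1..n}. u k ^ c k)) = 0"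
      by (simp add: prod_dividef left_diff_distrib diff_divide_distrib sum_subtractf)
  qed (use that finite_exponents in \<open>auto simp: exponents_def\<close>)
  then have "A c = eulerian_coeff n c" if "c \<in> exponents n" for c
    using that by simp
  moreover have "eulerian_coeff n \<in> extensional (exponents n)"
    by (simp add: eulerian_coeff_def)
  ultimately show "A = eulerian_coeff n"
    using A by (auto intro: extensionalityI)
qed

section \<open>Comparing monomials\<close>

lemma variable_power: "variable k ^ c = Poly_Mapping.single (Poly_Mapping.single k c) 1"
  by (induction c) (simp_all add: variable_def Poly_Mapping.mult_single Poly_Mapping.single_add[symmetric])

lemma prod_single_one:
  "(\<Prod>j\<in>J. Poly_Mapping.single (f j) (1 :: int)) = Poly_Mapping.single (\<Sum>j\<in>J. f j) 1"
  by (induction J rule: infinite_finite_induct) (simp_all add: Poly_Mapping.mult_single)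

lemma single_one_inject:
  assumes "Poly_Mapping.single x (1 :: int) = Poly_Mapping.single y 1"
  shows "x = y"
proof -
  have "Poly_Mapping.lookup (Poly_Mapping.single y (1 :: int)) x = 1"
    unfolding assms[symmetric] by simp
  then show ?thesis by (simp add: lookup_single when_def split: if_splits)
qed

text \<open>Both sides are single monomials with coefficient 1, so their exponents agree; on the
  left the exponent of k counts the occurrences of k in the word.\<close>

lemma monomials_eq_imp_mset_eq:
  assumes "(\<Prod>j=1..n. variable (i j)) = (\<Prod>k=1..n. variable k ^ c k)"
  shows "mset (map i [1..<Suc n]) = content_mset n c"
proof (rule multiset_eqI)
  fix k
  have "Poly_Mapping.single (\<Sum>j=1..n. Poly_Mapping.single (i j) (1 :: nat)) (1 :: int) =
    Poly_Mapping.single (\<Sum>k=1..n. Poly_Mapping.single k (c k)) 1"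
    using assms by (simp add: variable_power prod_single_one) (simp add: variable_def prod_single_one)
  then have "(\<Sum>j=1..n. Poly_Mapping.single (i j) (1 :: nat)) = (\<Sum>k=1..n. Poly_Mapping.single k (c k))"
    by (rule single_one_inject)
  from arg_cong[OF this, of "\<lambda>m. Poly_Mapping.lookup m k"]
  have "(\<Sum>j=1..n. if i j = k then 1 else 0 :: nat) = (if k \<in> {1..n} then c k else 0)"
    by (simp add: lookup_sum lookup_single when_def del: One_nat_def)
  moreover have "count (mset (map i [1..<Suc m])) k = (\<Sum>j=1..m. if i j = k then 1 else 0)" for m
    by (induction m) auto
  ultimately show "count (mset (map i [1..<Suc n])) k = count (content_mset n c) k"
    by (simp add: count_content_mset)
qed

theorem theorem17p7:
  fixes n :: nat and c i :: "nat \<Rightarrow> nat"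
  assumes "n \<ge> 1"
    and "(\<Sum>k=1..n. c k) = n"
    and "\<forall>j\<in>{1..n}. i j \<in> {1..n}"
    and "(\<Prod>j=1..n. variable (i j)) = (\<Prod>k=1..n. variable k ^ c k)"
  shows "mixed_eulerian n c =
    (\<Sum>(T, v) \<in> {(T, v) \<in> increasing_binary_trees n. compatible n i T v}.
       fact n * tree_weight n i T v)"
proof -
  have "restrict c {1..n} \<in> exponents n"
    using assms(2) by (auto simp: exponents_def)
  moreover have "content_mset n (restrict c {1..n}) = content_mset n c"
    by (simp add: content_mset_def)
  \<comment> \<open>Order independence replaces the sorted word by the given sequence, which is why
    every admissible sequence yields the same number.\<close>
  moreover have "word_weight 1 (Suc n) (sorted_list_of_multiset (content_mset n c)) =
     word_weight 1 (Suc n) (map i [1..<Suc n])"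
  proof (rule word_weight_mset_cong[symmetric])
    show "mset (map i [1..<Suc n]) = mset (sorted_list_of_multiset (content_mset n c))"
      using monomials_eq_imp_mset_eq[OF assms(4)] by simp
    show "set (map i [1..<Suc n]) \<subseteq> {1..<Suc n}"
      using assms(3) by (auto simp: less_Suc_eq_le simp del: upt_Suc)
  qed
  ultimately have "mixed_eulerian n c = fact n * word_weight 1 (Suc n) (map i [1..<Suc n])"
    by (simp add: mixed_eulerian_def mixed_eulerian_family_eq eulerian_coeff_def)
  also have "\<dots> = (\<Sum>(T, v) \<in> {(T, v) \<in> increasing_binary_trees n. compatible n i T v}.
       fact n * tree_weight n i T v)"
    unfolding sum_increasing_binary_trees[OF assms(3), symmetric]
    by (simp add: sum_distrib_left case_prod_unfold)
  finally show ?thesis .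
qed

end
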